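(* Let $s,t>0$ be fixed. Let $S_1:H_1\to G_1$ be a compact linear operator between Hilbert spaces with $\dim H_1=\infty$, let $\lambda_1\ge\lambda_2\ge\cdots\ge 0$ be the ordered eigenvalues (with multiplicity) of $W_1=S_1^*S_1$, and let $S=\{S_d\}_{d\in\mathbb{N}}$, $S_d=\bigotimes_{i=1}^d S_1$, be the associated linear tensor product problem. Assume $\lambda_2>0$ and $\lambda_1>1$. Consider the worst-case setting, the absolute error criterion, and the information class $\Lambda^{\mathrm{all}}$ of all continuous linear functionals. Then $S$ is ALG-$(s,t)$-weakly tractable if and only if $$t>1\qquad\text{and}\qquad \lim_{j\to\infty}\frac{\left(\ln\frac{1}{\lambda_j}\right)^t}{\ln j}=\infty .$$
   Context: $\mathbb{N}=\{1,2,\dots\}$. The eigenvalues of $W_1$ satisfy $\lim_{j\to\infty}\lambda_j=0$. If $\lambda_j=0$ for some $j$, one uses the convention $\ln\frac1{0}=\infty$, so that the limit condition holds in that case. For $d\in\mathbb{N}$, $S_d=\bigotimes_{i=1}^d S_1:H_d\to G_d$ is the $d$-fold tensor product operator, where $H_d=\bigotimes_{i=1}^d H_1$ and $G_d=\bigotimes_{i=1}^d G_1$ are Hilbert space tensor products. The eigenvalues of $W_d=S_d^*S_d$ are $\prod_{k=1}^d\lambda_{j_k}$, $(j_1,\dots,j_d)\in\mathbb{N}^d$; their non-increasing rearrangement is denoted $\lambda_{d,1}\ge\lambda_{d,2}\ge\cdots\ge 0$. Algorithms using $n$ pieces of information have the form $A_{n,d}(f)=\phi_{n,d}(L_1(f),\dots,L_n(f))$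 with $L_1,\dots,L_n\in\Lambda^{\mathrm{all}}=H_d^*$ and $\phi_{n,d}:\mathbb{R}^n\to G_d$ an arbitrary mapping. The $n$-th minimal worst-case error is $$e(n,d)=\inf_{A_{n,d}}\ \sup_{\|f\|_{H_d}\le 1}\|S_d(f)-A_{n,d}(f)\|_{G_d},\qquad e(0,d)=\sup_{\|f\|_{H_d}\le1}\|S_d(f)\|_{G_d}.$$ It is well known that $e(n,d)=\sqrt{\lambda_{d,n+1}}$. The information complexity for the absolute error criterion is, for $\varepsilon\in(0,1)$, $$n^{\mathrm{ABS}}(\varepsilon,S_d)=\min\{n : e(n,d)\le\varepsilon\}=\Big|\Big\{(j_1,\dots,j_d)\in\mathbb{N}^d:\ \prod_{k=1}^d\lambda_{j_k}>\varepsilon^2\Big\}\Big|,$$ where $|A|$ denotes the cardinality of $A$. For fixed $s,t>0$, $S$ is ALG-$(s,t)$-weakly tractable (for the absolute error criterion) if $$\lim_{\varepsilon^{-1}+d\to\infty}\frac{\ln n^{\mathrm{ABS}}(\varepsilon,S_d)}{\varepsilon^{-s}+d^t}=0,$$ the limit being over pairs $(\varepsilon,d)\in(0,1)\times\mathbb{N}$. *)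

theory Defs
  imports "HOL-Analysis.Analysis"
begin

text \<open>Hilbert spaces are real (information takes values in \<open>\<real>\<^sup>n\<close>). The spaces \<open>H\<^sub>1\<close>, \<open>G\<^sub>1\<close>
  are types of class \<open>real_inner\<close> and \<open>complete_space\<close>. The dimension \<open>d\<close> of the tensor powers
  varies inside the statement, so the spaces \<open>H\<^sub>d\<close>, \<open>d \<ge> 1\<close>, are closed subspaces of one ambient
  Hilbert space; any sequence of Hilbert spaces embeds isometrically in its Hilbert sum. Sequences
  are indexed from 1, and their value at 0 is ignored.\<close>

definition compact_operator :: "('a::real_normed_vector \<Rightarrow> 'b::real_normed_vector) \<Rightarrow> bool"
  where "compact_operator T \<longleftrightarrow> linear T \<and> compact (closure (T ` cball 0 1))"

text \<open>For a compact positive operator \<open>W\<close> on an infinite-dimensional space the following determines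
  \<open>lam\<close>. The eigenspace of any \<open>mu > 0\<close> has finite dimension, so \<^const>\<open>dim\<close> is its true dimension
  (\<^const>\<open>dim\<close> is 0 on infinite-dimensional spaces). Multiplicities are prescribed only for \<open>mu > 0\<close>:
  if infinitely many eigenvalues (with multiplicity) are positive then \<open>lam\<close> lists exactly these, and
  otherwise it ends in zeros.\<close>

definition ordered_eigenvalues :: "('a::real_vector \<Rightarrow> 'a) \<Rightarrow> (nat \<Rightarrow> real) \<Rightarrow> bool"
  where "ordered_eigenvalues W lam \<longleftrightarrow>
    (\<forall>i j. 1 \<le> i \<and> i \<le> j \<longrightarrow> lam j \<le> lam i) \<and>
    (\<forall>j\<ge>1. 0 \<le> lam j) \<and>
    (\<forall>mu>0. finite {j. 1 \<le> j \<and> lam j = mu} \<and>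
       card {j. 1 \<le> j \<and> lam j = mu} = dim {x. W x = mu *\<^sub>R x})"

text \<open>\<open>tau f\<close> is the elementary tensor \<open>f 1 \<otimes> \<dots> \<otimes> f d\<close>, and \<open>H\<close> is the completed span of these.
  The inner product formula already forces \<open>tau\<close> to be multilinear in \<open>f 1, \<dots>, f d\<close> and independent
  of the other values of \<open>f\<close> (the relevant differences have norm 0), so it makes \<open>(tau, H)\<close>
  the Hilbert space tensor power, uniquely up to isometric isomorphism.\<close>

definition hilbert_tensor_power ::
    "nat \<Rightarrow> ((nat \<Rightarrow> 'h::real_inner) \<Rightarrow> 'hd::{real_inner,complete_space}) \<Rightarrow> 'hd set \<Rightarrow> bool"
  where "hilbert_tensor_power d tau H \<longleftrightarrow>
    (\<forall>f g. tau f \<bullet> tau g = (\<Prod>i=1..d. f i \<bullet> g i)) \<and>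
    H = closure (span (range tau))"

text \<open>Here \<open>Sd\<close> is a bounded operator on the ambient space, of which only the restriction to
  \<open>H\<^sub>d\<close> matters. The restriction is determined by the values on elementary tensors and maps into
  \<open>G\<^sub>d\<close>. Conversely every bounded operator on the closed subspace \<open>H\<^sub>d\<close> extends, by composition with
  the orthogonal projection; this also applies to functionals below.\<close>

definition tensor_power_operator ::
    "('h \<Rightarrow> 'g) \<Rightarrow> ((nat \<Rightarrow> 'h) \<Rightarrow> 'hd::real_normed_vector) \<Rightarrow> ((nat \<Rightarrow> 'g) \<Rightarrow> 'gd::real_normed_vector)
      \<Rightarrow> ('hd \<Rightarrow> 'gd) \<Rightarrow> bool"
  where "tensor_power_operator S1 tau tau' Sd \<longleftrightarrow>
    bounded_linear Sd \<and> (\<forall>f. Sd (tau f) = tau' (\<lambda>i. S1 (f i)))"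

text \<open>Vectors of \<open>\<real>\<^sup>n\<close> are lists of length \<open>n\<close>.\<close>

definition algorithms :: "nat \<Rightarrow> 'gd set \<Rightarrow> ('hd::real_normed_vector \<Rightarrow> 'gd) set"
  where "algorithms n G = {A. \<exists>L :: nat \<Rightarrow> 'hd \<Rightarrow> real. \<exists>phi :: real list \<Rightarrow> 'gd.
    (\<forall>i\<in>{1..n}. bounded_linear (L i)) \<and> (\<forall>y. length y = n \<longrightarrow> phi y \<in> G) \<and>
    A = (\<lambda>f. phi (map (\<lambda>i. L i f) [1..<Suc n]))}"

text \<open>The errors are extended reals because the worst-case error of an algorithm may be infinite.\<close>

definition minimal_error ::
    "'hd::real_normed_vector set \<Rightarrow> 'gd::real_normed_vector set \<Rightarrow> ('hd \<Rightarrow> 'gd) \<Rightarrow> nat \<Rightarrow> ereal"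
  where "minimal_error H G Sd n =
    (if n = 0 then (SUP f\<in>{f\<in>H. norm f \<le> 1}. ereal (norm (Sd f)))
     else (INF A\<in>algorithms n G. SUP f\<in>{f\<in>H. norm f \<le> 1}. ereal (norm (Sd f - A f))))"

definition n_ABS ::
    "'hd::real_normed_vector set \<Rightarrow> 'gd::real_normed_vector set \<Rightarrow> ('hd \<Rightarrow> 'gd) \<Rightarrow> real \<Rightarrow> nat"
  where "n_ABS H G Sd eps = (LEAST n. minimal_error H G Sd n \<le> ereal eps)"

definition ALG_weakly_tractable ::
    "real \<Rightarrow> real \<Rightarrow> (nat \<Rightarrow> 'hd::real_normed_vector set) \<Rightarrow> (nat \<Rightarrow> 'gd::real_normed_vector set)
      \<Rightarrow> (nat \<Rightarrow> 'hd \<Rightarrow> 'gd) \<Rightarrow> bool"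
  where "ALG_weakly_tractable s t H G S \<longleftrightarrow>
    ((\<lambda>(eps, d). ln (real (n_ABS (H d) (G d) (S d) eps)) / ((1 / eps) powr s + real d powr t))
      \<longlongrightarrow> 0)
    (inf (filtercomap (\<lambda>(eps, d). 1 / eps + real d) at_top) (principal ({0<..<1} \<times> {1..})))"

text \<open>\<open>(ln (1 / x))\<^sup>t / ln j\<close> with the convention \<open>ln (1 / 0) = \<infinity>\<close>. The limit in \<open>j\<close> does not see the
  finitely many \<open>j\<close> where \<open>j \<le> 1\<close> or \<open>ln (1 / lam j)\<close> is not positive.\<close>

definition log_ratio :: "real \<Rightarrow> real \<Rightarrow> nat \<Rightarrow> ereal"
  where "log_ratio t x j = (if x = 0 then \<infinity> else ereal (ln (1 / x) powr t / ln (real j)))"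

end

theory Submission
  imports Defs
begin

text \<open>The eigenvectors \<open>e\<^sub>j\<close> of \<open>W\<^sub>1\<close> diagonalize the form \<open>S\<^sub>1 f \<bullet> S\<^sub>1 g\<close>, so their tensor products diagonalize
  \<open>S\<^sub>d\<close> on elementary tensors and, by density, on \<open>H\<^sub>d\<close>. Projecting onto the tensors with eigenvalue
  above \<open>\<epsilon>\<^sup>2\<close> has error at most \<open>\<epsilon>\<close>, and fewer functionals always miss a direction on which \<open>S\<^sub>d\<close> exceeds
  \<open>\<epsilon>\<close>; hence the information complexity counts these eigenvalues.

  Necessity: for fixed \<open>\<epsilon>\<close> the index tuples over \<open>{1, 2}\<close> with few twos are exponentially many in \<open>d\<close>,
  which forces \<open>t > 1\<close>; and if \<open>d\<close> is about \<open>ln (1 / \<lambda>\<^sub>J) / ln \<lambda>\<^sub>1\<close>, the tuples \<open>(j, 1, \<dots>, 1)\<close> with \<open>j \<le> J\<close>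
  all count, which bounds \<open>ln J\<close> by \<open>o ((ln (1 / \<lambda>\<^sub>J))\<^sup>t)\<close>. Sufficiency: weighting a tuple by
  \<open>\<Prod>k. exp (-\<delta> (ln (\<lambda>\<^sub>1 / \<lambda>\<^bsub>j k\<^esub>))\<^sup>t)\<close> with arbitrarily small \<open>\<delta>\<close> bounds the logarithm of the count by
  \<open>\<delta> (2 ln (1 / \<epsilon>) + d ln \<lambda>\<^sub>1)\<^sup>t + O (d)\<close>.\<close>

section \<open>Compact operators between Hilbert spaces\<close>

text \<open>The representing vector is the minimizer of the quadratic functional
  \<open>J x = x \<bullet> x - 2 * \<phi> x\<close>. A minimizing sequence is Cauchy by the
  parallelogram law, so completeness yields a minimizer, and vanishing of the derivative there is
  the claim.\<close>

lemma riesz_representation: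
  fixes \<phi> :: "'a::{real_inner,complete_space} \<Rightarrow> real"
  assumes "bounded_linear \<phi>"
  obtains z where "\<And>x. \<phi> x = x \<bullet> z"
proof -
  interpret \<phi>: bounded_linear \<phi> by fact
  define J where "J x = x \<bullet> x - 2 * \<phi> x" for x
  obtain K where K: "\<And>x. norm (\<phi> x) \<le> norm x * K"
    using \<phi>.bounded by blast
  have J_ge: "- K\<^sup>2 \<le> J x" for x
  proof -
    have "0 \<le> (norm x - K)\<^sup>2" by simp
    moreover have "\<phi> x \<le> norm x * K" using K[of x] by simp
    ultimately show ?thesis
      by (simp add: J_def dot_square_norm power2_diff)
  qed
  define m where "m = Inf (range J)"
  have bdd: "bdd_below (range J)"
    using J_ge by (intro bdd_belowI[of _ "- K\<^sup>2"]) auto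
  have m_le: "m \<le> J x" for x
    unfolding m_def using bdd by (intro cInf_lower) auto
  have "\<exists>x. J x < m + 1 / real (Suc n)" for n
    using cInf_lessD[of "range J" "m + 1 / real (Suc n)"] by (auto simp: m_def)
  then obtain X where X: "\<And>n. J (X n) < m + 1 / real (Suc n)"
    by metis
  \<comment> \<open>The parallelogram law; the linear parts of \<open>J\<close> cancel at the
    midpoint.\<close>
  have para: "J x + J y - 2 * J ((1/2) *\<^sub>R (x + y)) = (norm (x - y))\<^sup>2 / 2" for x y
    unfolding J_def power2_norm_eq_inner \<phi>.scaleR \<phi>.add
    by (simp add: inner_simps inner_commute algebra_simps add_divide_distrib)
  have dist_le: "(norm (X i - X j))\<^sup>2 \<le> 2 * (1 / real (Suc i) + 1 / real (Suc j))" for i j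
    using para[of "X i" "X j"] X[of i] X[of j] m_le[of "(1/2) *\<^sub>R (X i + X j)"] by simp
  have "Cauchy X"
  proof (rule metric_CauchyI)
    fix e :: real assume e: "e > 0"
    then obtain N :: nat where N: "4 / e\<^sup>2 < real N"
      using reals_Archimedean2 by blast
    have "dist (X i) (X j) < e" if "i \<ge> N" "j \<ge> N" for i j
    proof -
      have "N > 0" using N e by (cases N) (auto simp: divide_less_0_iff)
      have "1 / real (Suc i) \<le> 1 / real N" "1 / real (Suc j) \<le> 1 / real N"
        using that \<open>N > 0\<close> by (auto intro!: divide_left_mono)
      then have "(norm (X i - X j))\<^sup>2 \<le> 4 / real N"
        using dist_le[of i j] by simp
      also have "\<dots> < e\<^sup>2"
        using N e \<open>N > 0\<close> by (simp add: field_simps)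
      finally show ?thesis
        using e by (simp add: dist_norm power_less_imp_less_base)
    qed
    then show "\<exists>M. \<forall>i\<ge>M. \<forall>j\<ge>M. dist (X i) (X j) < e" by blast
  qed
  then obtain z where z: "X \<longlonglongrightarrow> z"
    using Cauchy_convergent convergent_def by blast
  have "(\<lambda>n. J (X n)) \<longlonglongrightarrow> J z"
    unfolding J_def by (intro tendsto_intros \<phi>.tendsto z)
  moreover have "(\<lambda>n. m + 1 / real (Suc n)) \<longlonglongrightarrow> m + 0"
    by (intro tendsto_add tendsto_const LIMSEQ_Suc lim_1_over_n)
  ultimately have "J z \<le> m"
    using X by (intro LIMSEQ_le[of "\<lambda>n. J (X n)" _ "\<lambda>n. m + 1 / real (Suc n)"]) (auto intro: less_imp_le)
  then have z_min: "J z \<le> J x" for x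
    using m_le order_trans by blast
  have "\<phi> h = h \<bullet> z" for h
  proof -
    define c where "c = z \<bullet> h - \<phi> h"
    have ge: "0 \<le> r\<^sup>2 * (h \<bullet> h) + 2 * r * c" for r
      using z_min[of "z + r *\<^sub>R h"] unfolding J_def c_def \<phi>.scaleR \<phi>.add
      by (simp add: inner_simps inner_commute algebra_simps power2_eq_square)
    have "c = 0"
    proof (cases "h = 0")
      case True then show ?thesis by (simp add: c_def \<phi>.zero)
    next
      case False
      then have "h \<bullet> h > 0" by simp
      \<comment> \<open>The quadratic in \<open>r\<close> takes its least value
        \<open>- c\<^sup>2 / (h \<bullet> h)\<close> at \<open>r = - c / (h \<bullet> h)\<close>,
        which is nonnegative only for \<open>c = 0\<close>.\<close>
      then show ?thesis
        using ge[of "- c / (h \<bullet> h)"] by (auto simp: field_simps power2_eq_square mult_le_0_iff)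
    qed
    then show ?thesis by (simp add: c_def inner_commute)
  qed
  then show ?thesis using that by blast
qed

text \<open>\<open>adjoint\<close> is defined by Hilbert choice, so its characteristic equation
  holds once some adjoint exists. Riesz representation of \<open>\<lambda>x. T x \<bullet> y\<close>
  provides one.\<close>

lemma adjoint_works_complete:
  fixes T :: "'a::{real_inner,complete_space} \<Rightarrow> 'b::real_inner"
  assumes "bounded_linear T"
  shows "T x \<bullet> y = x \<bullet> adjoint T y"
proof -
  have "\<exists>z. \<forall>x. T x \<bullet> y = x \<bullet> z" for y
  proof -
    have "bounded_linear (\<lambda>x. T x \<bullet> y)"
      using assms by (rule bounded_linear_inner_left_comp)
    then show ?thesis by (metis riesz_representation)
  qed
  then have "\<exists>f'. \<forall>x y. T x \<bullet> y = x \<bullet> f' y" by metis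
  from someI_ex[OF this] show ?thesis
    unfolding adjoint_def by blast
qed

lemma bounded_linear_adjoint:
  fixes T :: "'a::{real_inner,complete_space} \<Rightarrow> 'b::real_inner"
  assumes "bounded_linear T"
  shows "bounded_linear (adjoint T)"
proof -
  interpret T: bounded_linear T by fact
  note adj = adjoint_works_complete[OF assms]
  obtain K where K: "\<And>x. norm (T x) \<le> norm x * K" "K \<ge> 0"
    using T.nonneg_bounded by blast
  show ?thesis
  proof (rule bounded_linear_intro)
    show "adjoint T (x + y) = adjoint T x + adjoint T y" for x y
      by (rule vector_eq_rdot[THEN iffD1, rule_format, of _ _])
        (simp add: inner_commute[of "adjoint T _"] inner_add_left inner_add_right adj[symmetric])
    show "adjoint T (r *\<^sub>R x) = r *\<^sub>R adjoint T x" for r x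
      by (rule vector_eq_rdot[THEN iffD1, rule_format, of _ _])
        (simp add: inner_commute[of "adjoint T _"] adj[symmetric])
    show "norm (adjoint T y) \<le> norm y * K" for y
    proof (cases "adjoint T y = 0")
      case True
      then show ?thesis using K(2) by simp
    next
      case False
      have "norm (adjoint T y) * norm (adjoint T y) = T (adjoint T y) \<bullet> y"
        by (simp add: adj norm_eq_sqrt_inner)
      also have "\<dots> \<le> norm (T (adjoint T y)) * norm y"
        by (rule norm_cauchy_schwarz)
      also have "\<dots> \<le> norm (adjoint T y) * K * norm y"
        by (intro mult_right_mono K) auto
      finally show ?thesis using False by (simp add: mult_ac)
    qed
  qed
qed

lemma compact_operator_bounded_linear:
  assumes "compact_operator T"
  shows "bounded_linear T"
proof -
  interpret linear T using assms by (simp add: compact_operator_def)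
  have "bounded (T ` cball 0 1)"
    using assms bounded_subset[OF compact_imp_bounded closure_subset]
    by (auto simp: compact_operator_def)
  then obtain K where K: "\<And>x. norm x \<le> 1 \<Longrightarrow> norm (T x) \<le> K"
    unfolding bounded_iff by (metis image_eqI mem_cball_0)
  show ?thesis
  proof (rule bounded_linear_intro)
    fix x
    show "norm (T x) \<le> norm x * K"
    proof (cases "x = 0")
      case False
      have "norm (T ((1 / norm x) *\<^sub>R x)) \<le> K" using False by (intro K) simp
      then show ?thesis using False by (simp add: scale field_simps)
    qed (simp add: zero)
  qed (simp_all add: add scale)
qed

section \<open>Spectral decomposition of a compact operator\<close>

text \<open>The maximum of \<open>norm (T x)\<close> on the unit ball of \<open>M\<close> is attained, because a maximizing
  sequence \<open>X\<close> satisfies \<open>T\<^sup>* T X n - \<sigma>\<^sup>2 X n \<longlonglongrightarrow> 0\<close>.\<close>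

lemma compact_operator_norm_attained:
  fixes T :: "'a::{real_inner,complete_space} \<Rightarrow> 'b::real_inner"
  assumes T: "compact_operator T" and "subspace M" "closed M"
    and inv: "\<And>x. x \<in> M \<Longrightarrow> adjoint T (T x) \<in> M"
    and x0: "x0 \<in> M" "T x0 \<noteq> 0"
  obtains x \<sigma> where "x \<in> M" "x \<noteq> 0" "\<sigma> > 0" "adjoint T (T x) = \<sigma>\<^sup>2 *\<^sub>R x"
    "\<And>y. y \<in> M \<Longrightarrow> norm (T y) \<le> \<sigma> * norm y"
proof -
  interpret T: bounded_linear T using T by (rule compact_operator_bounded_linear)
  note adj = adjoint_works_complete[OF T.bounded_linear_axioms]
  define Q where "Q = {norm (T x) |x. x \<in> M \<and> norm x \<le> 1}"
  define \<sigma> where "\<sigma> = Sup Q"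
  obtain K where K: "\<And>x. norm (T x) \<le> norm x * K" "K \<ge> 0"
    using T.nonneg_bounded by blast
  have "0 \<in> M" using \<open>subspace M\<close> by (rule subspace_0)
  then have Qne: "Q \<noteq> {}" by (auto simp: Q_def intro!: exI[of _ 0])
  have "norm (T x) \<le> K" if "norm x \<le> 1" for x
    using K(1)[of x] mult_right_mono[OF that K(2)] by simp
  then have bdd: "bdd_above Q" by (auto simp: Q_def bdd_above_def)
  have T_le: "norm (T y) \<le> \<sigma> * norm y" if "y \<in> M" for y
  proof (cases "y = 0")
    case False
    have "norm (T ((1 / norm y) *\<^sub>R y)) \<in> Q"
      using that False \<open>subspace M\<close> by (auto simp: Q_def intro!: exI[of _ "(1 / norm y) *\<^sub>R y"] subspace_scale)
    then have "norm (T ((1 / norm y) *\<^sub>R y)) \<le> \<sigma>"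
      unfolding \<sigma>_def using bdd by (rule cSup_upper)
    then show ?thesis using False by (simp add: T.scaleR field_simps)
  qed (simp add: T.zero)
  have \<sigma>: "\<sigma> > 0"
    using T_le[OF x0(1)] x0(2) by (smt (verit) mult_nonneg_nonneg mult_nonpos_nonneg norm_ge_zero zero_less_norm_iff)
  \<comment> \<open>Invariance of \<open>M\<close> allows \<open>T_le\<close> to be applied to
    \<open>adjoint T (T x)\<close> as well as to \<open>x\<close>, which gives one factor
    \<open>\<sigma>\<close> each.\<close>
  have W_le: "norm (adjoint T (T x)) \<le> \<sigma>\<^sup>2" if x: "x \<in> M" "norm x \<le> 1" for x
  proof (cases "adjoint T (T x) = 0")
    case False
    let ?w = "adjoint T (T x)"
    have "norm ?w * norm ?w = T ?w \<bullet> T x"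
      by (simp add: adj norm_eq_sqrt_inner)
    also have "\<dots> \<le> norm (T ?w) * norm (T x)"
      by (rule norm_cauchy_schwarz)
    also have "\<dots> \<le> (\<sigma> * norm ?w) * (\<sigma> * norm x)"
      using T_le[OF inv[OF x(1)]] T_le[OF x(1)] \<sigma> by (intro mult_mono) auto
    also have "\<dots> \<le> (\<sigma> * norm ?w) * (\<sigma> * 1)"
      using x \<sigma> by (intro mult_left_mono) auto
    finally show ?thesis using False by (simp add: power2_eq_square mult_ac)
  qed simp
  have "\<exists>x. x \<in> M \<and> norm x \<le> 1 \<and> \<sigma> - 1 / real (Suc n) < norm (T x)" for n
    using less_cSupD[OF Qne, of "\<sigma> - 1 / real (Suc n)"] by (auto simp: \<sigma>_def Q_def)
  then obtain X where X: "\<And>n. X n \<in> M" "\<And>n. norm (X n) \<le> 1"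
    "\<And>n. \<sigma> - 1 / real (Suc n) < norm (T (X n))"
    by metis
  have "seq_compact (closure (T ` cball 0 1))"
    using T by (simp add: compact_operator_def compact_imp_seq_compact)
  moreover have "\<forall>n. (T \<circ> X) n \<in> closure (T ` cball 0 1)"
    using X(2) closure_subset by fastforce
  ultimately obtain y r where r: "strict_mono r" "((T \<circ> X) \<circ> r) \<longlonglongrightarrow> y"
    unfolding seq_compact_def by metis
  define Y where "Y = X \<circ> r"
  have TY: "(\<lambda>n. T (Y n)) \<longlonglongrightarrow> y"
    using r(2) by (simp add: Y_def o_def)
  have "(\<lambda>n. norm (T (X n))) \<longlonglongrightarrow> \<sigma>"
  proof (rule tendsto_sandwich)
    show "\<forall>\<^sub>F n in sequentially. \<sigma> - 1 / real (Suc n) \<le> norm (T (X n))"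
      using X(3) by (simp add: less_imp_le)
    show "\<forall>\<^sub>F n in sequentially. norm (T (X n)) \<le> \<sigma>"
      using T_le[OF X(1)] X(2) \<sigma> by (intro always_eventually allI) (smt (verit) mult_left_le)
    have "(\<lambda>n. \<sigma> - 1 / real (Suc n)) \<longlonglongrightarrow> \<sigma> - 0"
      by (intro tendsto_diff tendsto_const LIMSEQ_Suc lim_1_over_n)
    then show "(\<lambda>n. \<sigma> - 1 / real (Suc n)) \<longlonglongrightarrow> \<sigma>" by simp
  qed simp
  then have nTY: "(\<lambda>n. norm (T (Y n))) \<longlonglongrightarrow> \<sigma>"
    using LIMSEQ_subseq_LIMSEQ[OF _ r(1)] by (fastforce simp: Y_def o_def)
  have Y: "Y n \<in> M" "norm (Y n) \<le> 1" for n
    using X by (auto simp: Y_def)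
  define D where "D n = adjoint T (T (Y n)) - \<sigma>\<^sup>2 *\<^sub>R Y n" for n
  \<comment> \<open>Expanding the square and using \<open>W_le\<close> leaves \<open>2 *
    \<sigma>\<^sup>2 * (\<sigma>\<^sup>2 - (norm (T (Y n)))\<^sup>2)\<close>, which tends to 0
    because \<open>Y\<close> is maximizing.\<close>
  have D_le: "(norm (D n))\<^sup>2 \<le> 2 * \<sigma>^4 - 2 * \<sigma>\<^sup>2 * (norm (T (Y n)))\<^sup>2" for n
  proof -
    let ?w = "adjoint T (T (Y n))"
    have "(norm (D n))\<^sup>2 = (norm ?w)\<^sup>2 - 2 * \<sigma>\<^sup>2 * (norm (T (Y n)))\<^sup>2 + \<sigma>^4 * (norm (Y n))\<^sup>2"
      unfolding D_def power2_norm_eq_inner adj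
      by (simp add: inner_simps inner_commute algebra_simps)
    also have "(norm ?w)\<^sup>2 \<le> (\<sigma>\<^sup>2)\<^sup>2"
      by (intro power_mono W_le Y) auto
    also have "\<sigma>^4 * (norm (Y n))\<^sup>2 \<le> \<sigma>^4 * 1"
      using Y(2)[of n] by (intro mult_left_mono) (auto simp: power_le_one)
    finally show ?thesis by simp
  qed
  have "(\<lambda>n. 2 * \<sigma>^4 - 2 * \<sigma>\<^sup>2 * (norm (T (Y n)))\<^sup>2) \<longlonglongrightarrow> 2 * \<sigma>^4 - 2 * \<sigma>\<^sup>2 * \<sigma>\<^sup>2"
    by (intro tendsto_intros nTY)
  moreover have "2 * \<sigma>^4 - 2 * \<sigma>\<^sup>2 * \<sigma>\<^sup>2 = 0"
    by (simp flip: power_add)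
  ultimately have lim0: "(\<lambda>n. 2 * \<sigma>^4 - 2 * \<sigma>\<^sup>2 * (norm (T (Y n)))\<^sup>2) \<longlonglongrightarrow> 0"
    by simp
  have "(\<lambda>n. (norm (D n))\<^sup>2) \<longlonglongrightarrow> 0"
    by (rule tendsto_sandwich[OF _ _ tendsto_const lim0]) (simp_all add: D_le)
  then have "(\<lambda>n. sqrt ((norm (D n))\<^sup>2)) \<longlonglongrightarrow> sqrt 0"
    by (rule tendsto_real_sqrt)
  then have D0: "D \<longlonglongrightarrow> 0" by (simp add: tendsto_norm_zero_iff)
  \<comment> \<open>Compactness only makes \<open>T (Y n)\<close> converge. Since \<open>D\<close>
    tends to 0, \<open>\<sigma>\<^sup>2 *\<^sub>R Y n\<close> has the same limit as
    \<open>adjoint T (T (Y n))\<close>, namely \<open>adjoint T y\<close>; hence \<open>Y\<close>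
    itself converges.\<close>
  define x where "x = (1 / \<sigma>\<^sup>2) *\<^sub>R adjoint T y"
  have "(\<lambda>n. (1 / \<sigma>\<^sup>2) *\<^sub>R (adjoint T (T (Y n)) - D n)) \<longlonglongrightarrow> (1 / \<sigma>\<^sup>2) *\<^sub>R (adjoint T y - 0)"
    by (intro tendsto_intros D0 bounded_linear.tendsto[OF bounded_linear_adjoint[OF T.bounded_linear_axioms]] TY)
  then have Yx: "Y \<longlonglongrightarrow> x"
    using \<sigma> by (simp add: D_def x_def)
  show ?thesis
  proof
    show "x \<in> M" using \<open>closed M\<close> Y(1) Yx by (metis closed_sequentially)
    have yTx: "y = T x"
      using LIMSEQ_unique[OF TY T.tendsto[OF Yx]] .
    have "norm (T x) = \<sigma>"
      using LIMSEQ_unique[OF nTY tendsto_norm[OF TY]] yTx by simp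
    then show "x \<noteq> 0" using \<sigma> T.zero by auto
    show "\<sigma> > 0" by fact
    show "adjoint T (T x) = \<sigma>\<^sup>2 *\<^sub>R x"
      unfolding yTx[symmetric] using \<sigma> by (simp add: x_def)
  qed (rule T_le)
qed

text \<open>Orthogonal images of norm at least \<open>\<delta>\<close> are at least
  \<open>\<delta>\<close> apart, while finitely many balls of radius \<open>\<delta> / 2\<close>
  cover the image of the unit ball. No ball contains two of the images, so the number of balls is
  the bound. This is the only form in which compactness enters the finiteness of eigenspaces and the
  decay of \<open>lam\<close>.\<close>

lemma compact_operator_orthogonal_card_bound:
  assumes "compact_operator T" "\<delta> > 0"
  obtains K :: nat where "\<And>F. finite F \<Longrightarrow> (\<And>x. x \<in> F \<Longrightarrow> norm x \<le> 1 \<and> \<delta> \<le> norm (T x)) \<Longrightarrow>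
    pairwise (\<lambda>x y. orthogonal (T x) (T y)) F \<Longrightarrow> card F \<le> K"
proof -
  have "\<exists>k. finite k \<and> closure (T ` cball 0 1) \<subseteq> (\<Union>x\<in>k. ball x (\<delta> / 2))"
    using assms by (auto simp: compact_operator_def compact_eq_totally_bounded)
  then obtain k where k: "finite k" "closure (T ` cball 0 1) \<subseteq> (\<Union>x\<in>k. ball x (\<delta> / 2))"
    by blast
  have "card F \<le> card k"
    if F: "finite F" "\<And>x. x \<in> F \<Longrightarrow> norm x \<le> 1 \<and> \<delta> \<le> norm (T x)"
      "pairwise (\<lambda>x y. orthogonal (T x) (T y)) F" for F
  proof -
    have "\<exists>z\<in>k. dist z (T x) < \<delta> / 2" if "x \<in> F" for x
    proof -
      have "T x \<in> closure (T ` cball 0 1)"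
        using F(2)[OF that] closure_subset by fastforce
      then have "T x \<in> (\<Union>x\<in>k. ball x (\<delta> / 2))" using k(2) by blast
      then show ?thesis unfolding UN_iff mem_ball .
    qed
    then obtain g where g: "\<And>x. x \<in> F \<Longrightarrow> g x \<in> k \<and> dist (g x) (T x) < \<delta> / 2"
      by metis
    have "inj_on g F"
    proof (rule inj_onI, rule ccontr)
      fix x y assume xy: "x \<in> F" "y \<in> F" "g x = g y" "x \<noteq> y"
      then have "T x \<bullet> T y = 0"
        using F(3) by (auto simp: pairwise_def orthogonal_def)
      then have "(norm (T x - T y))\<^sup>2 = (norm (T x))\<^sup>2 + (norm (T y))\<^sup>2"
        by (simp add: power2_norm_eq_inner inner_simps inner_commute)
      also have "\<dots> \<ge> \<delta>\<^sup>2 + 0"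
        using F(2)[OF xy(1)] assms(2) by (intro add_mono power_mono) auto
      finally have "\<delta>\<^sup>2 \<le> (norm (T x - T y))\<^sup>2" by simp
      then have "\<delta> \<le> dist (T x) (T y)"
        unfolding dist_norm by (rule power2_le_imp_le) simp
      moreover have "dist (g y) (T x) < \<delta> / 2" "dist (g y) (T y) < \<delta> / 2"
        using g[OF xy(1)] g[OF xy(2)] xy(3) by simp_all
      then have "dist (T x) (T y) < \<delta>"
        by (rule dist_triangle_half_r)
      ultimately show False by simp
    qed
    moreover have "g ` F \<subseteq> k" using g by auto
    ultimately show ?thesis using k(1) by (rule card_inj_on_le)
  qed
  then show ?thesis using that by blast
qed

lemma orthonormal_spanning_set:
  fixes B :: "'a::real_inner set"
  assumes "finite B"
  obtains C where "finite C" "span C = span B" "pairwise orthogonal C" "\<And>x. x \<in> C \<Longrightarrow> norm x = 1"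
proof -
  obtain C where C: "finite C" "span C = span B" "pairwise orthogonal C"
    using basis_orthogonal[OF assms] by blast
  \<comment> \<open>\<open>C\<close> may contain 0, which has to be discarded before
    normalizing.\<close>
  let ?C = "(\<lambda>x. (1 / norm x) *\<^sub>R x) ` (C - {0})"
  show ?thesis
  proof
    have "span ?C = span (C - {0})"
      using C by (intro span_image_scale) auto
    then show "span ?C = span B" using C by simp
    show "pairwise orthogonal ?C"
      using C(3) by (auto simp: pairwise_def orthogonal_def)
    show "norm x = 1" if "x \<in> ?C" for x
      using that by (auto split: if_splits)
  qed (use C in simp)
qed

lemma card_orthonormal_eq_dim:
  fixes C :: "'a::real_inner set"
  assumes "pairwise orthogonal C" "\<And>x. x \<in> C \<Longrightarrow> norm x = 1"
  shows "card C = dim (span C)"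
proof -
  have "independent C"
    using assms(1)
  proof (rule pairwise_orthogonal_independent)
    show "0 \<notin> C" using assms(2)[of 0] by auto
  qed
  then show ?thesis by (metis dim_span_eq_card_independent)
qed

text \<open>On the eigenspace \<open>T x \<bullet> T y = \<mu> * (x \<bullet> y)\<close>, so
  orthonormal eigenvectors have orthogonal images of norm \<open>sqrt \<mu>\<close>. Their number is
  bounded, hence the eigenspace has finite dimension and orthogonalization applies.\<close>

lemma eigenspace_orthonormal_basis:
  fixes T :: "'a::{real_inner,complete_space} \<Rightarrow> 'b::real_inner"
  assumes T: "compact_operator T" and "\<mu> > 0"
  obtains C where "finite C" "span C = {x. adjoint T (T x) = \<mu> *\<^sub>R x}"
    "pairwise orthogonal C" "\<And>x. x \<in> C \<Longrightarrow> norm x = 1"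
proof -
  define V where "V = {x. adjoint T (T x) = \<mu> *\<^sub>R x}"
  interpret T: bounded_linear T using T by (rule compact_operator_bounded_linear)
  interpret T': bounded_linear "adjoint T" by (rule bounded_linear_adjoint) (rule T.bounded_linear_axioms)
  note adj = adjoint_works_complete[OF T.bounded_linear_axioms]
  have V: "subspace V"
    by (auto simp: subspace_def V_def T.zero T'.zero T.add T'.add T.scaleR T'.scaleR scaleR_right_distrib)
  obtain K :: nat where K: "\<And>F. finite F \<Longrightarrow> (\<And>x. x \<in> F \<Longrightarrow> norm x \<le> 1 \<and> sqrt \<mu> \<le> norm (T x)) \<Longrightarrow>
    pairwise (\<lambda>x y. orthogonal (T x) (T y)) F \<Longrightarrow> card F \<le> K"
    using compact_operator_orthogonal_card_bound[OF T, of "sqrt \<mu>"] \<open>\<mu> > 0\<close> by auto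
  have inner_T: "T x \<bullet> T y = \<mu> * (x \<bullet> y)" if "y \<in> V" for x y
    using that by (simp add: adj V_def)
  have card_le: "card B \<le> K" if B: "finite B" "independent B" "B \<subseteq> V" for B
  proof -
    obtain C where C: "finite C" "span C = span B" "pairwise orthogonal C" "\<And>x. x \<in> C \<Longrightarrow> norm x = 1"
      using orthonormal_spanning_set[OF B(1)] by metis
    have CV: "C \<subseteq> V"
      using C(2) B(3) V span_minimal span_superset by blast
    have "card B = card C"
      using card_orthonormal_eq_dim[OF C(3,4)] C(2) B(2) by (simp add: dim_eq_card_independent)
    also have "\<dots> \<le> K"
    proof (rule K[OF C(1)])
      show "norm x \<le> 1 \<and> sqrt \<mu> \<le> norm (T x)" if "x \<in> C" for x
        using inner_T[of x x] C(4)[OF that] that CV by (auto simp: norm_eq_sqrt_inner)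
      show "pairwise (\<lambda>x y. orthogonal (T x) (T y)) C"
        using C(3) CV inner_T by (auto simp: pairwise_def orthogonal_def)
    qed
    finally show ?thesis .
  qed
  obtain B where B: "B \<subseteq> V" "independent B" "V \<subseteq> span B"
    using basis_exists[of V] by metis
  have "finite B"
  proof (rule ccontr)
    assume "infinite B"
    then obtain B' where "B' \<subseteq> B" "finite B'" "card B' = Suc K"
      using infinite_arbitrarily_large by blast
    then show False
      using card_le[of B'] B independent_mono by fastforce
  qed
  then obtain C where C: "finite C" "span C = span B" "pairwise orthogonal C" "\<And>x. x \<in> C \<Longrightarrow> norm x = 1"
    using orthonormal_spanning_set by metis
  moreover have "span B = V"
    using B V by (simp add: span_subspace)
  ultimately show ?thesis using that unfolding V_def by blast
qed

text \<open>The vectors belonging to \<open>lam j = 0\<close> are chosen to be 0, so that sums over eigenvectors need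
  not be restricted to positive eigenvalues.\<close>

lemma ordered_eigenvectors:
  fixes T :: "'a::{real_inner,complete_space} \<Rightarrow> 'b::real_inner"
  assumes T: "compact_operator T" and lam: "ordered_eigenvalues (adjoint T \<circ> T) lam"
  obtains e where "\<And>i j. 1 \<le> i \<Longrightarrow> 1 \<le> j \<Longrightarrow> e i \<bullet> e j = (if i = j \<and> lam i > 0 then 1 else 0)"
    "\<And>j. 1 \<le> j \<Longrightarrow> adjoint T (T (e j)) = lam j *\<^sub>R e j"
    "\<And>\<mu> x. \<mu> > 0 \<Longrightarrow> adjoint T (T x) = \<mu> *\<^sub>R x \<Longrightarrow> x \<in> span (e ` {j. 1 \<le> j \<and> lam j = \<mu>})"
proof -
  interpret T: bounded_linear T using T by (rule compact_operator_bounded_linear)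
  note adj = adjoint_works_complete[OF T.bounded_linear_axioms]
  interpret T': bounded_linear "adjoint T" by (rule bounded_linear_adjoint) (rule T.bounded_linear_axioms)
  define I where "I \<mu> = {j. 1 \<le> j \<and> lam j = \<mu>}" for \<mu>
  define V where "V \<mu> = {x. adjoint T (T x) = \<mu> *\<^sub>R x}" for \<mu>
  have nonneg: "0 \<le> lam j" if "1 \<le> j" for j
    using lam that by (auto simp: ordered_eigenvalues_def)
  have "\<exists>C h. span C = V \<mu> \<and> pairwise orthogonal C \<and> (\<forall>x\<in>C. norm x = 1) \<and> bij_betw h (I \<mu>) C"
    if \<mu>: "\<mu> > 0" for \<mu>
  proof -
    obtain C where C: "finite C" "span C = V \<mu>" "pairwise orthogonal C" "\<And>x. x \<in> C \<Longrightarrow> norm x = 1"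
      using eigenspace_orthonormal_basis[OF T \<mu>] unfolding V_def by metis
    \<comment> \<open>The multiplicity prescribed by \<open>ordered_eigenvalues\<close> is the
      dimension of the eigenspace, that is \<open>card C\<close>. The indices with value
      \<open>\<mu>\<close> can therefore label the orthonormal basis \<open>C\<close>
      bijectively.\<close>
    have "finite (I \<mu>)" "card (I \<mu>) = card C"
      using lam \<mu> card_orthonormal_eq_dim[OF C(3,4)] C(2)
      by (auto simp: ordered_eigenvalues_def I_def V_def)
    then show ?thesis
      using finite_same_card_bij[of "I \<mu>" C] C by blast
  qed
  then obtain C h where C: "\<And>\<mu>. \<mu> > 0 \<Longrightarrow> span (C \<mu>) = V \<mu>" "\<And>\<mu>. \<mu> > 0 \<Longrightarrow> pairwise orthogonal (C \<mu>)"
    "\<And>\<mu> x. \<mu> > 0 \<Longrightarrow> x \<in> C \<mu> \<Longrightarrow> norm x = 1"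
    and h: "\<And>\<mu>. \<mu> > 0 \<Longrightarrow> bij_betw (h \<mu>) (I \<mu>) (C \<mu>)"
    by metis
  define e where "e j = (if lam j > 0 then h (lam j) j else 0)" for j
  have eC: "e j \<in> C (lam j)" if "1 \<le> j" "lam j > 0" for j
    using h[OF that(2)] that by (auto simp: e_def I_def dest: bij_betwE)
  have eV: "adjoint T (T (e j)) = lam j *\<^sub>R e j" if "1 \<le> j" for j
  proof (cases "lam j > 0")
    case True
    then show ?thesis using eC[OF that True] C(1)[OF True] span_superset unfolding V_def by blast
  qed (simp add: e_def T.zero T'.zero)
  show ?thesis
  proof
    fix i j :: nat assume ij: "1 \<le> i" "1 \<le> j"
    show "e i \<bullet> e j = (if i = j \<and> lam i > 0 then 1 else 0)"
    proof (cases "lam i > 0 \<and> lam j > 0")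
      case pos: True
      show ?thesis
      proof (cases "lam i = lam j")
        case True
        have "e i \<noteq> e j" if "i \<noteq> j"
        proof -
          have "inj_on (h (lam i)) (I (lam i))"
            using h pos by (auto simp: bij_betw_def)
          then show ?thesis
            using ij that True pos by (auto simp: e_def I_def inj_on_def)
        qed
        moreover have "e i \<in> C (lam i)" "e j \<in> C (lam i)"
          using eC[OF ij(1)] eC[OF ij(2)] pos True by auto
        ultimately show ?thesis
          using pos C(2)[of "lam i"] C(3)[of "lam i" "e i"]
          by (auto simp: pairwise_def orthogonal_def norm_eq_1)
      next
        case False
        \<comment> \<open>Eigenvectors for different eigenvalues are orthogonal: symmetry evaluates
          \<open>T (e i) \<bullet> T (e j)\<close> in two ways.\<close>
        have "lam j * (e i \<bullet> e j) = T (e i) \<bullet> T (e j)"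
          by (simp add: adj eV[OF ij(2)])
        also have "\<dots> = lam i * (e i \<bullet> e j)"
          using adj[of "e j" "T (e i)"] by (simp add: eV[OF ij(1)] inner_commute)
        finally show ?thesis using False by auto
      qed
    qed (use nonneg[OF ij(1)] nonneg[OF ij(2)] in \<open>auto simp: e_def\<close>)
  next
    fix \<mu> x assume \<mu>: "\<mu> > 0" "adjoint T (T x) = \<mu> *\<^sub>R x"
    have "e ` I \<mu> = h \<mu> ` I \<mu>"
      using \<mu>(1) by (intro image_cong) (auto simp: e_def I_def)
    also have "\<dots> = C \<mu>" using h[OF \<mu>(1)] by (simp add: bij_betw_def)
    finally show "x \<in> span (e ` {j. 1 \<le> j \<and> lam j = \<mu>})"
      using C(1)[OF \<mu>(1)] \<mu>(2) by (simp add: I_def V_def)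
  qed (rule eV)
qed

text \<open>The vectors \<open>e j\<close> do not cover the kernel of \<open>T\<close>, so
  \<open>f\<close> itself need not be the sum of its expansion. The form
  \<open>T f \<bullet> T g\<close> is nevertheless diagonal, because the remainder of the expansion
  is orthogonal to the first \<open>m\<close> eigenvectors and \<open>T\<close> maps it to a vector
  of norm at most \<open>sqrt (lam (Suc m)) * norm f\<close>.\<close>

lemma compact_operator_eigenbasis:
  fixes T :: "'a::{real_inner,complete_space} \<Rightarrow> 'b::real_inner"
  assumes T: "compact_operator T" and lam: "ordered_eigenvalues (adjoint T \<circ> T) lam"
  obtains e where "lam \<longlonglongrightarrow> 0"
    "\<And>i j. 1 \<le> i \<Longrightarrow> 1 \<le> j \<Longrightarrow> e i \<bullet> e j = (if i = j \<and> lam i > 0 then 1 else 0)"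
    "\<And>i j. 1 \<le> i \<Longrightarrow> 1 \<le> j \<Longrightarrow> T (e i) \<bullet> T (e j) = (if i = j then lam i else 0)"
    "\<And>f g. (\<lambda>m. \<Sum>j=1..m. lam j * ((f \<bullet> e j) * (g \<bullet> e j))) \<longlonglongrightarrow> T f \<bullet> T g"
proof (rule ordered_eigenvectors[OF T lam])
  fix e :: "nat \<Rightarrow> 'a"
  interpret T: bounded_linear T using T by (rule compact_operator_bounded_linear)
  note adj = adjoint_works_complete[OF T.bounded_linear_axioms]
  have decr: "lam j \<le> lam i" if "1 \<le> i" "i \<le> j" for i j
    using lam that by (auto simp: ordered_eigenvalues_def)
  have nonneg: "0 \<le> lam j" if "1 \<le> j" for j
    using lam that by (auto simp: ordered_eigenvalues_def)
  assume e: "\<And>i j. 1 \<le> i \<Longrightarrow> 1 \<le> j \<Longrightarrow> e i \<bullet> e j = (if i = j \<and> lam i > 0 then 1 else 0)"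
    and W: "\<And>j. 1 \<le> j \<Longrightarrow> adjoint T (T (e j)) = lam j *\<^sub>R e j"
    and span_e: "\<And>\<mu> x. \<mu> > 0 \<Longrightarrow> adjoint T (T x) = \<mu> *\<^sub>R x \<Longrightarrow> x \<in> span (e ` {j. 1 \<le> j \<and> lam j = \<mu>})"
  have Te: "T x \<bullet> T (e j) = lam j * (x \<bullet> e j)" if "1 \<le> j" for x j
    using that by (simp add: adj W)
  have Tee: "T (e i) \<bullet> T (e j) = (if i = j then lam i else 0)" if "1 \<le> i" "1 \<le> j" for i j
    using that nonneg[of i] by (auto simp: Te e)
  have lam0: "lam \<longlonglongrightarrow> 0"
  proof (rule LIMSEQ_I)
    fix r :: real assume r: "r > 0"
    obtain K :: nat where K: "\<And>F. finite F \<Longrightarrow> (\<And>x. x \<in> F \<Longrightarrow> norm x \<le> 1 \<and> sqrt r \<le> norm (T x)) \<Longrightarrow>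
      pairwise (\<lambda>x y. orthogonal (T x) (T y)) F \<Longrightarrow> card F \<le> K"
      using compact_operator_orthogonal_card_bound[OF T, of "sqrt r"] r by auto
    have "lam (Suc K) < r"
    proof (rule ccontr)
      assume "\<not> lam (Suc K) < r"
      then have ge: "lam j \<ge> r" if "j \<in> {1..Suc K}" for j
        using decr[of j "Suc K"] that by auto
      have "inj_on e {1..Suc K}"
      proof (rule inj_onI, rule ccontr)
        fix i j assume ij: "i \<in> {1..Suc K}" "j \<in> {1..Suc K}" "e i = e j" "i \<noteq> j"
        then show False using e[of i j] e[of i i] ge[OF ij(1)] r by auto
      qed
      then have "card (e ` {1..Suc K}) = Suc K" by (simp add: card_image)
      moreover have "card (e ` {1..Suc K}) \<le> K"
      proof (rule K)
        show "norm x \<le> 1 \<and> sqrt r \<le> norm (T x)" if "x \<in> e ` {1..Suc K}" for x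
        proof -
          obtain j where j: "j \<in> {1..Suc K}" "x = e j" using \<open>x \<in> _\<close> by blast
          then show ?thesis
            using e[of j j] Tee[of j j] ge[OF j(1)] r by (auto simp: norm_eq_sqrt_inner)
        qed
        show "pairwise (\<lambda>x y. orthogonal (T x) (T y)) (e ` {1..Suc K})"
        proof (rule pairwiseI)
          fix x y assume "x \<in> e ` {1..Suc K}" "y \<in> e ` {1..Suc K}" "x \<noteq> y"
          then obtain i j where "1 \<le> i" "1 \<le> j" "i \<noteq> j" "x = e i" "y = e j" by force
          then show "orthogonal (T x) (T y)" by (simp add: orthogonal_def Tee)
        qed
      qed auto
      ultimately show False by simp
    qed
    then have "norm (lam j - 0) < r" if "j \<ge> Suc K" for j
      using decr[of "Suc K" j] nonneg[of j] that by simp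
    then show "\<exists>no. \<forall>n\<ge>no. norm (lam n - 0) < r" by blast
  qed
  have T_le: "(norm (T x))\<^sup>2 \<le> lam m * (norm x)\<^sup>2"
    if m: "1 \<le> m" and x: "\<And>j. 1 \<le> j \<Longrightarrow> j < m \<Longrightarrow> x \<bullet> e j = 0" for m x
  proof (cases "T x = 0")
    case True
    then show ?thesis using nonneg[OF m] by simp
  next
    case False
    \<comment> \<open>The orthogonal complement of the first \<open>m - 1\<close> eigenvectors is
      closed and invariant, so the norm of \<open>T\<close> on it is attained at an
      eigenvector.\<close>
    define M where "M = {x. \<forall>j. 1 \<le> j \<and> j < m \<longrightarrow> x \<bullet> e j = 0}"
    have "subspace M" by (auto simp: subspace_def M_def inner_simps)
    have "M = (\<Inter>j\<in>{1..<m}. {x. x \<bullet> e j = 0})" by (auto simp: M_def)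
    also have "closed \<dots>"
      by (intro closed_INT ballI closed_Collect_eq continuous_intros)
    finally have "closed M" .
    have inv: "adjoint T (T y) \<in> M" if "y \<in> M" for y
    proof -
      have "adjoint T (T y) \<bullet> e j = lam j * (y \<bullet> e j)" if "1 \<le> j" for j
        using adj[of "e j" "T y"] Te[OF that, of y] by (simp add: inner_commute)
      then show ?thesis using that by (simp add: M_def)
    qed
    have "x \<in> M" using x by (simp add: M_def)
    then obtain z \<sigma> where z: "z \<in> M" "z \<noteq> 0" "\<sigma> > 0" "adjoint T (T z) = \<sigma>\<^sup>2 *\<^sub>R z"
      "\<And>y. y \<in> M \<Longrightarrow> norm (T y) \<le> \<sigma> * norm y"
      using compact_operator_norm_attained[OF T \<open>subspace M\<close> \<open>closed M\<close> inv _ False] by metis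
    \<comment> \<open>If the eigenvalue exceeded \<open>lam m\<close>, all its indices would lie
      below \<open>m\<close>. Then \<open>z\<close> would be in the span of vectors to which it is
      orthogonal.\<close>
    have "\<sigma>\<^sup>2 \<le> lam m"
    proof (rule ccontr)
      assume "\<not> \<sigma>\<^sup>2 \<le> lam m"
      then have "j < m" if "1 \<le> j" "lam j = \<sigma>\<^sup>2" for j
        using decr[OF m, of j] that by force
      then have "\<And>y. y \<in> e ` {j. 1 \<le> j \<and> lam j = \<sigma>\<^sup>2} \<Longrightarrow> orthogonal z y"
        using z(1) by (auto simp: M_def orthogonal_def)
      moreover have "z \<in> span (e ` {j. 1 \<le> j \<and> lam j = \<sigma>\<^sup>2})"
        using z by (intro span_e) auto
      ultimately have "orthogonal z z"
        using orthogonal_to_span by blast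
      then show False using z(2) by (simp add: orthogonal_self)
    qed
    have "(norm (T x))\<^sup>2 \<le> (\<sigma> * norm x)\<^sup>2"
      by (intro power_mono z(5) \<open>x \<in> M\<close>) auto
    also have "\<dots> = \<sigma>\<^sup>2 * (norm x)\<^sup>2" by (simp add: power_mult_distrib)
    also have "\<dots> \<le> lam m * (norm x)\<^sup>2"
      by (intro mult_right_mono \<open>\<sigma>\<^sup>2 \<le> lam m\<close>) auto
    finally show ?thesis .
  qed
  have lim: "(\<lambda>m. \<Sum>j=1..m. lam j * ((f \<bullet> e j) * (g \<bullet> e j))) \<longlonglongrightarrow> T f \<bullet> T g" for f g
  proof -
    \<comment> \<open>\<open>p m\<close> is the projection of \<open>f\<close> onto the span of the
      first \<open>m\<close> eigenvectors and \<open>q m\<close> is the remainder.\<close>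
    define p where "p m = (\<Sum>j=1..m. (f \<bullet> e j) *\<^sub>R e j)" for m
    define q where "q m = f - p m" for m
    have pe: "p m \<bullet> e j = f \<bullet> e j" if "1 \<le> j" "j \<le> m" for m j
    proof -
      have "p m \<bullet> e j = (\<Sum>i=1..m. if i = j then (if lam j > 0 then f \<bullet> e j else 0) else 0)"
        unfolding p_def inner_sum_left using that by (intro sum.cong) (auto simp: e)
      also have "\<dots> = (if lam j > 0 then f \<bullet> e j else 0)"
        using that by (subst sum.delta) auto
      also have "\<dots> = f \<bullet> e j"
        using e[of j j] nonneg[of j] that by auto
      finally show ?thesis .
    qed
    then have qe: "q m \<bullet> e j = 0" if "1 \<le> j" "j \<le> m" for m j
      using that by (simp add: q_def inner_simps)
    have "q m \<bullet> p m = 0" for m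
      by (simp add: p_def inner_sum_right qe)
    then have "(norm f)\<^sup>2 = (norm (q m))\<^sup>2 + (norm (p m))\<^sup>2" for m
      using norm_add_Pythagorean[of "q m" "p m"] by (simp add: orthogonal_def q_def)
    then have q_le: "(norm (q m))\<^sup>2 \<le> (norm f)\<^sup>2" for m
      by (metis le_add_same_cancel1 zero_le_power2)
    have "norm (T (q m)) \<le> sqrt (lam (Suc m) * (norm f)\<^sup>2)" for m
    proof -
      have "(norm (T (q m)))\<^sup>2 \<le> lam (Suc m) * (norm (q m))\<^sup>2"
        by (intro T_le qe) auto
      also have "\<dots> \<le> lam (Suc m) * (norm f)\<^sup>2"
        by (intro mult_left_mono q_le nonneg) auto
      finally show ?thesis by (rule real_le_rsqrt)
    qed
    moreover have "(\<lambda>m. sqrt (lam (Suc m) * (norm f)\<^sup>2)) \<longlonglongrightarrow> sqrt (0 * (norm f)\<^sup>2)"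
      by (intro tendsto_intros LIMSEQ_Suc lam0)
    ultimately have "(\<lambda>m. T (q m)) \<longlonglongrightarrow> 0"
      by (intro Lim_null_comparison[of "\<lambda>m. T (q m)" "\<lambda>m. sqrt (lam (Suc m) * (norm f)\<^sup>2)"]) auto
    then have "(\<lambda>m. T f \<bullet> T g - T (q m) \<bullet> T g) \<longlonglongrightarrow> T f \<bullet> T g - 0 \<bullet> T g"
      by (intro tendsto_intros)
    moreover have "T f \<bullet> T g - T (q m) \<bullet> T g = (\<Sum>j=1..m. lam j * ((f \<bullet> e j) * (g \<bullet> e j)))" for m
    proof -
      have "T f \<bullet> T g - T (q m) \<bullet> T g = T (p m) \<bullet> T g"
        by (simp add: q_def T.diff inner_simps)
      also have "\<dots> = (\<Sum>j=1..m. (f \<bullet> e j) * (T g \<bullet> T (e j)))"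
        by (simp add: p_def T.sum T.scaleR inner_sum_left inner_commute[of "T g"])
      also have "\<dots> = (\<Sum>j=1..m. lam j * ((f \<bullet> e j) * (g \<bullet> e j)))"
        by (intro sum.cong) (auto simp: Te)
      finally show ?thesis .
    qed
    ultimately show ?thesis by simp
  qed
  show ?thesis by (rule that[OF lam0 e Tee lim])
qed

section \<open>Information complexity of tensor powers\<close>

text \<open>Gaussian elimination for \<open>n\<close> homogeneous equations in more than
  \<open>n\<close> unknowns: the last equation eliminates one unknown \<open>b\<close>, and
  induction handles the remaining system.\<close>

lemma exists_nontrivial_relation:
  fixes v :: "nat \<Rightarrow> 'a \<Rightarrow> 'b::field"
  assumes "finite A" "n < card A"
  shows "\<exists>c. (\<exists>a\<in>A. c a \<noteq> 0) \<and> (\<forall>i\<in>{1..n}. (\<Sum>a\<in>A. c a * v i a) = 0)"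
  using assms
proof (induction n arbitrary: A v)
  case 0
  then show ?case by (intro exI[of _ "\<lambda>_. 1"]) (auto simp: card_gt_0_iff)
next
  case (Suc n)
  show ?case
  proof (cases "\<forall>a\<in>A. v (Suc n) a = 0")
    case True
    obtain c where "\<exists>a\<in>A. c a \<noteq> 0" "\<forall>i\<in>{1..n}. (\<Sum>a\<in>A. c a * v i a) = 0"
      using Suc.IH[of A v] Suc.prems by auto
    then show ?thesis using True by (intro exI[of _ c]) (auto simp: atLeastAtMostSuc_conv)
  next
    case False
    then obtain b where b: "b \<in> A" "v (Suc n) b \<noteq> 0" by blast
    \<comment> \<open>\<open>w\<close> is the system after subtracting the multiple of column
      \<open>b\<close> that clears equation \<open>Suc n\<close>; that equation becomes trivial. The
      coefficient \<open>c' b\<close> below undoes the substitution.\<close>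
    define w where "w i a = v i a - v (Suc n) a / v (Suc n) b * v i b" for i a
    have "n < card (A - {b})" using Suc.prems b(1) by simp
    then obtain c where c: "\<exists>a\<in>A - {b}. c a \<noteq> 0" "\<forall>i\<in>{1..n}. (\<Sum>a\<in>A - {b}. c a * w i a) = 0"
      using Suc.IH[of "A - {b}" w] Suc.prems by auto
    define c' where "c' = c(b := - (\<Sum>a\<in>A - {b}. c a * (v (Suc n) a / v (Suc n) b)))"
    have sum_eq: "(\<Sum>a\<in>A. c' a * v i a) = (\<Sum>a\<in>A - {b}. c a * w i a)" for i
    proof -
      have "(\<Sum>a\<in>A. c' a * v i a) = c' b * v i b + (\<Sum>a\<in>A - {b}. c' a * v i a)"
        using Suc.prems b by (intro sum.remove) auto
      also have "(\<Sum>a\<in>A - {b}. c' a * v i a) = (\<Sum>a\<in>A - {b}. c a * v i a)"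
        by (intro sum.cong) (auto simp: c'_def)
      also have "c' b * v i b = - (\<Sum>a\<in>A - {b}. c a * (v (Suc n) a / v (Suc n) b * v i b))"
        by (simp add: c'_def sum_distrib_right mult.assoc)
      finally show ?thesis
        by (simp add: w_def right_diff_distrib sum_subtractf)
    qed
    have "w (Suc n) a = 0" for a using b(2) by (simp add: w_def)
    then have "\<forall>i\<in>{1..Suc n}. (\<Sum>a\<in>A. c' a * v i a) = 0"
      using c(2) by (auto simp: sum_eq atLeastAtMostSuc_conv)
    moreover have "\<exists>a\<in>A. c' a \<noteq> 0" using c(1) by (auto simp: c'_def)
    ultimately show ?thesis by blast
  qed
qed

text \<open>The squared norms \<open>l i\<close> are arbitrary so that the identity serves both the
  orthonormal tensors \<open>E j\<close> and their images under \<open>Sd\<close>, whose squared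
  norms are eigenvalues.\<close>

lemma orthogonal_sum_power2_norm:
  fixes E :: "'i \<Rightarrow> 'a::real_inner"
  assumes "finite F" "\<And>i j. i \<in> F \<Longrightarrow> j \<in> F \<Longrightarrow> E i \<bullet> E j = (if i = j then l i else 0)"
  shows "(norm (\<Sum>j\<in>F. c j *\<^sub>R E j))\<^sup>2 = (\<Sum>j\<in>F. (c j)\<^sup>2 * l j)"
proof -
  have "(norm (\<Sum>j\<in>F. c j *\<^sub>R E j))\<^sup>2 = (\<Sum>j\<in>F. (norm (c j *\<^sub>R E j))\<^sup>2)"
    using assms by (intro norm_sum_Pythagorean) (auto simp: pairwise_def orthogonal_def)
  also have "\<dots> = (\<Sum>j\<in>F. (c j)\<^sup>2 * l j)"
  proof (intro sum.cong refl)
    show "(norm (c j *\<^sub>R E j))\<^sup>2 = (c j)\<^sup>2 * l j" if "j \<in> F" for j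
      using assms(2)[OF that that] by (simp add: power_mult_distrib power2_norm_eq_inner)
  qed
  finally show ?thesis .
qed

text \<open>\<open>p\<close> is the orthogonal projection onto the span of the family, and
  Pythagoras gives both the finite Bessel inequality and the bound on the residual.\<close>

lemma orthonormal_residual:
  fixes E :: "'i \<Rightarrow> 'a::real_inner"
  assumes "finite F" "\<And>i j. i \<in> F \<Longrightarrow> j \<in> F \<Longrightarrow> E i \<bullet> E j = (if i = j then 1 else 0)"
  defines "p \<equiv> \<lambda>x. \<Sum>j\<in>F. (x \<bullet> E j) *\<^sub>R E j"
  shows "j \<in> F \<Longrightarrow> (x - p x) \<bullet> E j = 0"
    and "(\<Sum>j\<in>F. (x \<bullet> E j)\<^sup>2) \<le> (norm x)\<^sup>2"
    and "norm (x - p x) \<le> norm x"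
proof -
  have res: "(x - p x) \<bullet> E j = 0" if "j \<in> F" for j
  proof -
    have "p x \<bullet> E j = (\<Sum>i\<in>F. if i = j then x \<bullet> E j else 0)"
      unfolding p_def inner_sum_left using that assms(2) by (intro sum.cong) auto
    then show ?thesis using that assms(1) by (simp add: inner_simps)
  qed
  then show "j \<in> F \<Longrightarrow> (x - p x) \<bullet> E j = 0" .
  have "(x - p x) \<bullet> p x = 0"
    using res by (simp add: p_def inner_sum_right)
  then have pyth: "(norm x)\<^sup>2 = (norm (x - p x))\<^sup>2 + (norm (p x))\<^sup>2"
    using norm_add_Pythagorean[of "x - p x" "p x"] by (simp add: orthogonal_def)
  moreover have "(norm (p x))\<^sup>2 = (\<Sum>j\<in>F. (x \<bullet> E j)\<^sup>2)"
    unfolding p_def using orthogonal_sum_power2_norm[OF assms(1), of E "\<lambda>_. 1"] assms(2) by auto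
  ultimately show "(\<Sum>j\<in>F. (x \<bullet> E j)\<^sup>2) \<le> (norm x)\<^sup>2"
    using zero_le_power2[of "norm (x - p x)"] by linarith
  have "(norm (x - p x))\<^sup>2 \<le> (norm x)\<^sup>2"
    using pyth zero_le_power2[of "norm (p x)"] by linarith
  then show "norm (x - p x) \<le> norm x"
    by (rule power2_le_imp_le) simp
qed

lemma subspace_closure:
  fixes S :: "'a::real_normed_vector set"
  assumes "subspace S"
  shows "subspace (closure S)"
  unfolding subspace_def
proof (intro conjI ballI allI)
  show "0 \<in> closure S"
    using subspace_0[OF assms] closure_subset by blast
  show "x + y \<in> closure S" if xy: "x \<in> closure S" "y \<in> closure S" for x y
  proof -
    obtain a b where "\<And>n. a n \<in> S" "a \<longlonglongrightarrow> x" "\<And>n. b n \<in> S" "b \<longlonglongrightarrow> y"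
      using xy unfolding closure_sequential by blast
    then have "\<forall>n. a n + b n \<in> S" "(\<lambda>n. a n + b n) \<longlonglongrightarrow> x + y"
      using assms by (auto intro: subspace_add tendsto_add)
    then show ?thesis unfolding closure_sequential by (intro exI[of _ "\<lambda>n. a n + b n"]) blast
  qed
  show "c *\<^sub>R x \<in> closure S" if x: "x \<in> closure S" for c x
  proof -
    obtain a where "\<And>n. a n \<in> S" "a \<longlonglongrightarrow> x"
      using x unfolding closure_sequential by blast
    then have "\<forall>n. c *\<^sub>R a n \<in> S" "(\<lambda>n. c *\<^sub>R a n) \<longlonglongrightarrow> c *\<^sub>R x"
      using assms by (auto intro: subspace_scale tendsto_scaleR)
    then show ?thesis unfolding closure_sequential by (intro exI[of _ "\<lambda>n. c *\<^sub>R a n"]) blast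
  qed
qed

section \<open>Eigenvalues of tensor powers and their index sets\<close>

definition tensor_eigenvalue :: "(nat \<Rightarrow> real) \<Rightarrow> nat \<Rightarrow> (nat \<Rightarrow> nat) \<Rightarrow> real"
  where "tensor_eigenvalue lam d j = (\<Prod>k=1..d. lam (j k))"

text \<open>Extensional functions have a fixed value outside \<open>{1..d}\<close>, so every index
  tuple is represented exactly once and the cardinality counts eigenvalues with
  multiplicity.\<close>

definition large_indices :: "(nat \<Rightarrow> real) \<Rightarrow> nat \<Rightarrow> real \<Rightarrow> (nat \<Rightarrow> nat) set"
  where "large_indices lam d x = {j \<in> {1..d} \<rightarrow>\<^sub>E {1..}. x < tensor_eigenvalue lam d j}"

locale eigenvalue_sequence =
  fixes lam :: "nat \<Rightarrow> real"
  assumes decr: "1 \<le> i \<Longrightarrow> i \<le> j \<Longrightarrow> lam j \<le> lam i"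
    and nonneg: "1 \<le> j \<Longrightarrow> 0 \<le> lam j"
    and lam_tendsto: "lam \<longlonglongrightarrow> 0"
begin

lemma tensor_eigenvalue_nonneg: "j \<in> {1..d} \<rightarrow>\<^sub>E {1..} \<Longrightarrow> 0 \<le> tensor_eigenvalue lam d j"
  unfolding tensor_eigenvalue_def by (intro prod_nonneg ballI nonneg) auto

lemma tensor_eigenvalue_posD:
  assumes "j \<in> {1..d} \<rightarrow>\<^sub>E {1..}" "0 < tensor_eigenvalue lam d j" "k \<in> {1..d}"
  shows "0 < lam (j k)"
proof -
  have "lam (j k) \<noteq> 0"
  proof
    assume "lam (j k) = 0"
    then have "tensor_eigenvalue lam d j = 0"
      unfolding tensor_eigenvalue_def using assms(3) by (intro prod_zero) auto
    then show False using assms(2) by simp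
  qed
  moreover have "0 \<le> lam (j k)" using assms by (intro nonneg) auto
  ultimately show ?thesis by simp
qed

text \<open>All other factors of the product are at most \<open>c\<close>, so a single entry
  \<open>j k\<close> with \<open>lam (j k) < x / c ^ (d - 1)\<close> already forces the product
  below \<open>x\<close>.\<close>

lemma large_indices_bounded:
  assumes "0 < x"
  obtains m where "large_indices lam d x \<subseteq> {1..d} \<rightarrow>\<^sub>E {1..m}"
proof -
  \<comment> \<open>The maximum with 1 keeps the divisor \<open>c ^ (d - 1)\<close> positive even if
    \<open>lam 1 = 0\<close>.\<close>
  define c where "c = max 1 (lam 1)"
  have c: "c > 0" "\<And>j. 1 \<le> j \<Longrightarrow> lam j \<le> c"
    using decr[of 1] by (force simp: c_def)+
  have "eventually (\<lambda>n. lam n < x / c ^ (d - 1)) sequentially"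
    using assms c by (intro order_tendstoD(2)[OF lam_tendsto]) auto
  then obtain m where m: "\<And>n. n \<ge> m \<Longrightarrow> lam n < x / c ^ (d - 1)"
    by (auto simp: eventually_sequentially)
  have "j k \<le> m" if j: "j \<in> large_indices lam d x" and k: "k \<in> {1..d}" for j k
  proof (rule ccontr)
    assume "\<not> j k \<le> m"
    have jP: "\<And>i. i \<in> {1..d} \<Longrightarrow> 1 \<le> j i" using j by (auto simp: large_indices_def)
    have "tensor_eigenvalue lam d j = lam (j k) * (\<Prod>i\<in>{1..d} - {k}. lam (j i))"
      unfolding tensor_eigenvalue_def using k by (intro prod.remove) auto
    also have "\<dots> \<le> lam (j k) * (\<Prod>i\<in>{1..d} - {k}. c)"
      using jP k nonneg c by (intro mult_left_mono prod_mono) auto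
    also have "\<dots> = lam (j k) * c ^ (d - 1)" using k by simp
    also have "\<dots> < x" using m[of "j k"] c \<open>\<not> j k \<le> m\<close> by (simp add: pos_less_divide_eq)
    finally show False using j by (simp add: large_indices_def)
  qed
  then have "j \<in> {1..d} \<rightarrow>\<^sub>E {1..m}" if "j \<in> large_indices lam d x" for j
    using that by (simp add: large_indices_def PiE_iff)
  then have "large_indices lam d x \<subseteq> {1..d} \<rightarrow>\<^sub>E {1..m}" by blast
  then show ?thesis using that by blast
qed

lemma finite_large_indices: "0 < x \<Longrightarrow> finite (large_indices lam d x)"
  by (metis large_indices_bounded finite_subset finite_PiE finite_atLeastAtMost)

end

section \<open>Diagonalization of the tensor power operator\<close>

text \<open>One dimension \<open>d\<close> is fixed. The assumptions on \<open>e\<close> are the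
  conclusions of \<open>compact_operator_eigenbasis\<close>, so compactness of \<open>S1\<close> is
  not referred to again.\<close>

locale tensor_eigenbasis = eigenvalue_sequence lam for lam :: "nat \<Rightarrow> real" +
  fixes S1 :: "'h::real_inner \<Rightarrow> 'g::real_inner" and e :: "nat \<Rightarrow> 'h" and d :: nat
    and tau :: "(nat \<Rightarrow> 'h) \<Rightarrow> 'hd::{real_inner,complete_space}" and H
    and tau' :: "(nat \<Rightarrow> 'g) \<Rightarrow> 'gd::{real_inner,complete_space}" and G and Sd
  assumes e_inner: "1 \<le> i \<Longrightarrow> 1 \<le> j \<Longrightarrow> e i \<bullet> e j = (if i = j \<and> lam i > 0 then 1 else 0)"
    and S1e_inner: "1 \<le> i \<Longrightarrow> 1 \<le> j \<Longrightarrow> S1 (e i) \<bullet> S1 (e j) = (if i = j then lam i else 0)"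
    and S1_inner: "(\<lambda>m. \<Sum>j=1..m. lam j * ((f \<bullet> e j) * (g \<bullet> e j))) \<longlonglongrightarrow> S1 f \<bullet> S1 g"
    and tensor_H: "hilbert_tensor_power d tau H"
    and tensor_G: "hilbert_tensor_power d tau' G"
    and tensor_S: "tensor_power_operator S1 tau tau' Sd"
begin

sublocale Sd: bounded_linear Sd
  using tensor_S by (simp add: tensor_power_operator_def)

definition E :: "(nat \<Rightarrow> nat) \<Rightarrow> 'hd" where "E j = tau (\<lambda>k. e (j k))"

abbreviation ev :: "(nat \<Rightarrow> nat) \<Rightarrow> real" where "ev \<equiv> tensor_eigenvalue lam d"

lemma tau_inner: "tau f \<bullet> tau g = (\<Prod>i=1..d. f i \<bullet> g i)"
  using tensor_H by (simp add: hilbert_tensor_power_def)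

lemma Sd_tau_inner: "Sd (tau f) \<bullet> Sd (tau g) = (\<Prod>i=1..d. S1 (f i) \<bullet> S1 (g i))"
  using tensor_G tensor_S by (simp add: hilbert_tensor_power_def tensor_power_operator_def)

lemma prod_kronecker:
  fixes a :: "nat \<Rightarrow> real"
  assumes "i \<in> {1..d} \<rightarrow>\<^sub>E B" "j \<in> {1..d} \<rightarrow>\<^sub>E B"
  shows "(\<Prod>k=1..d. if i k = j k then a k else 0) = (if i = j then \<Prod>k=1..d. a k else 0)"
proof (cases "i = j")
  case False
  \<comment> \<open>Distinct extensional functions differ at a coordinate inside
    \<open>{1..d}\<close>, where the product has a zero factor.\<close>
  then obtain k where "k \<in> {1..d}" "i k \<noteq> j k"
    using PiE_ext[OF assms] by blast
  then show ?thesis using False by (auto intro!: prod_zero)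
qed simp

text \<open>Positivity of \<open>ev i\<close> guarantees that every \<open>e (i k)\<close> is a unit
  vector and not the conventional 0 attached to a zero eigenvalue.\<close>

lemma E_inner:
  assumes "i \<in> {1..d} \<rightarrow>\<^sub>E {1..}" "j \<in> {1..d} \<rightarrow>\<^sub>E {1..}" "0 < ev i"
  shows "E i \<bullet> E j = (if i = j then 1 else 0)"
proof -
  have "E i \<bullet> E j = (\<Prod>k=1..d. if i k = j k then 1 else 0)"
    unfolding E_def tau_inner
  proof (intro prod.cong refl)
    fix k assume k: "k \<in> {1..d}"
    then have "1 \<le> i k" "1 \<le> j k" using assms by auto
    then show "e (i k) \<bullet> e (j k) = (if i k = j k then 1 else 0)"
      using tensor_eigenvalue_posD[OF assms(1,3) k] by (simp add: e_inner)
  qed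
  then show ?thesis using prod_kronecker[OF assms(1,2), of "\<lambda>_. 1"] by simp
qed

lemma Sd_E_inner:
  assumes "i \<in> {1..d} \<rightarrow>\<^sub>E {1..}" "j \<in> {1..d} \<rightarrow>\<^sub>E {1..}"
  shows "Sd (E i) \<bullet> Sd (E j) = (if i = j then ev i else 0)"
proof -
  have "Sd (E i) \<bullet> Sd (E j) = (\<Prod>k=1..d. if i k = j k then lam (i k) else 0)"
    unfolding E_def Sd_tau_inner
  proof (intro prod.cong refl)
    fix k assume k: "k \<in> {1..d}"
    then have "1 \<le> i k" "1 \<le> j k" using assms by auto
    then show "S1 (e (i k)) \<bullet> S1 (e (j k)) = (if i k = j k then lam (i k) else 0)"
      by (simp add: S1e_inner)
  qed
  then show ?thesis using prod_kronecker[OF assms, of "\<lambda>k. lam (i k)"] by (simp add: tensor_eigenvalue_def)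
qed

text \<open>For elementary tensors the sum over the box \<open>{1..m}\<close> to the power
  \<open>d\<close> factors into \<open>d\<close> one-dimensional sums, which converge by
  \<open>S1_inner\<close>. Both sides are bilinear, so the limit extends to the span in one argument
  and, by symmetry, in the other.\<close>

lemma Sd_inner_tendsto:
  assumes "x \<in> span (range tau)" "y \<in> span (range tau)"
  shows "(\<lambda>m. \<Sum>j\<in>{1..d} \<rightarrow>\<^sub>E {1..m}. ev j * ((x \<bullet> E j) * (y \<bullet> E j))) \<longlonglongrightarrow> Sd x \<bullet> Sd y"
proof -
  define P where "P x y \<longleftrightarrow>
    (\<lambda>m. \<Sum>j\<in>{1..d} \<rightarrow>\<^sub>E {1..m}. ev j * ((x \<bullet> E j) * (y \<bullet> E j))) \<longlonglongrightarrow> Sd x \<bullet> Sd y" for x y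
  have P_sym: "P x y \<longleftrightarrow> P y x" for x y
    unfolding P_def by (simp add: mult_ac inner_commute[of "Sd x"])
  have P_tau: "P (tau f) (tau g)" for f g
  proof -
    have eq: "(\<Sum>j\<in>{1..d} \<rightarrow>\<^sub>E {1..m}. ev j * ((tau f \<bullet> E j) * (tau g \<bullet> E j)))
      = (\<Prod>i=1..d. \<Sum>k=1..m. lam k * ((f i \<bullet> e k) * (g i \<bullet> e k)))" for m
      by (subst prod_sum_PiE) (auto simp: tensor_eigenvalue_def E_def tau_inner prod.distrib)
    show ?thesis
      unfolding P_def Sd_tau_inner eq by (intro tendsto_prod S1_inner)
  qed
  have sub: "subspace {x. P x y}" for y
    unfolding subspace_def
  proof (intro conjI ballI allI; clarsimp)
    show "P 0 y" by (simp add: P_def Sd.zero)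
    show "P (a + b) y" if "P a y" "P b y" for a b
      using tendsto_add[OF that[unfolded P_def]]
      by (simp add: P_def Sd.add inner_simps ring_distribs flip: sum.distrib)
    show "P (c *\<^sub>R a) y" if "P a y" for a c
      using tendsto_mult_left[OF that[unfolded P_def], of c]
      by (simp add: P_def Sd.scaleR sum_distrib_left mult_ac)
  qed
  have "P x (tau g)" for g
    using span_minimal[OF _ sub, of "range tau" "tau g"] P_tau assms(1) by blast
  then have "P y x"
    using span_minimal[OF _ sub, of "range tau" x] P_sym assms(2) by blast
  then show ?thesis using P_sym by (simp add: P_def)
qed

lemma E_in_span: "E j \<in> span (range tau)"
  by (simp add: E_def span_base)

lemma E_in_H: "E j \<in> H"
  using tensor_H E_in_span closure_subset by (auto simp: hilbert_tensor_power_def)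

lemma subspace_H: "subspace H"
  using tensor_H by (simp add: hilbert_tensor_power_def subspace_closure)

lemma Sd_E_in_G: "Sd (E j) \<in> G"
proof -
  have "Sd (E j) \<in> span (range tau')"
    using tensor_S by (simp add: tensor_power_operator_def E_def span_base)
  then show ?thesis
    using tensor_G closure_subset by (auto simp: hilbert_tensor_power_def)
qed

lemma subspace_G: "subspace G"
  using tensor_G by (simp add: hilbert_tensor_power_def subspace_closure)

section \<open>Upper and lower bounds for the minimal error\<close>

context
  fixes eps :: real and A
  assumes eps: "0 < eps"
  defines "A \<equiv> large_indices lam d (eps\<^sup>2)"
begin

lemma finite_A: "finite A"
  unfolding A_def using eps by (intro finite_large_indices) simp

lemma A_D:
  assumes "j \<in> A"
  shows "j \<in> {1..d} \<rightarrow>\<^sub>E {1..}" "eps\<^sup>2 < ev j" "0 < ev j"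
proof -
  show "j \<in> {1..d} \<rightarrow>\<^sub>E {1..}" "eps\<^sup>2 < ev j"
    using assms unfolding A_def large_indices_def by simp_all
  then show "0 < ev j" using zero_le_power2[of eps] by linarith
qed

lemma E_inner_A: "i \<in> A \<Longrightarrow> j \<in> A \<Longrightarrow> E i \<bullet> E j = (if i = j then 1 else 0)"
  by (intro E_inner A_D)

text \<open>The residual has no component along \<open>E j\<close> for \<open>j \<in> A\<close>, and
  outside \<open>A\<close> the eigenvalues are at most \<open>eps\<^sup>2\<close>; Bessel's
  inequality then bounds the diagonal form. This works on the span of the elementary tensors, and
  continuity carries the estimate to \<open>H\<close>.\<close>

lemma truncation_error:
  assumes "x \<in> H"
  shows "norm (Sd (x - (\<Sum>j\<in>A. (x \<bullet> E j) *\<^sub>R E j))) \<le> eps * norm x"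
proof -
  define r where "r x = x - (\<Sum>j\<in>A. (x \<bullet> E j) *\<^sub>R E j)" for x
  have span_case: "norm (Sd (r x)) - eps * norm x \<le> 0" if x: "x \<in> span (range tau)" for x
  proof -
    note res = orthonormal_residual[OF finite_A E_inner_A]
    have r: "r x \<in> span (range tau)"
      unfolding r_def using x E_in_span by (intro span_diff span_sum span_scale)
    have "(\<Sum>j\<in>{1..d} \<rightarrow>\<^sub>E {1..m}. ev j * ((r x \<bullet> E j) * (r x \<bullet> E j))) \<le> eps\<^sup>2 * (norm (r x))\<^sup>2" for m
    proof -
      \<comment> \<open>\<open>E_inner\<close> gives orthonormality only for positive eigenvalues;
        terms with eigenvalue 0 vanish and are removed before Bessel's inequality is used.\<close>
      define I where "I = {j \<in> {1..d} \<rightarrow>\<^sub>E {1..m}. 0 < ev j}"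
      have fin: "finite ({1..d} \<rightarrow>\<^sub>E {1..m})" by (intro finite_PiE) auto
      have sub: "{1..d} \<rightarrow>\<^sub>E {1..m} \<subseteq> {1..d} \<rightarrow>\<^sub>E {1..}" by (intro PiE_mono) auto
      have "(\<Sum>j\<in>{1..d} \<rightarrow>\<^sub>E {1..m}. ev j * ((r x \<bullet> E j) * (r x \<bullet> E j)))
        = (\<Sum>j\<in>I. ev j * ((r x \<bullet> E j) * (r x \<bullet> E j)))"
      proof (rule sum.mono_neutral_right)
        show "\<forall>j\<in>({1..d} \<rightarrow>\<^sub>E {1..m}) - I. ev j * ((r x \<bullet> E j) * (r x \<bullet> E j)) = 0"
        proof
          fix j assume j: "j \<in> ({1..d} \<rightarrow>\<^sub>E {1..m}) - I"
          then have "0 \<le> ev j" using sub by (intro tensor_eigenvalue_nonneg) blast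
          moreover have "\<not> 0 < ev j" using j unfolding I_def by blast
          ultimately show "ev j * ((r x \<bullet> E j) * (r x \<bullet> E j)) = 0" by simp
        qed
      qed (use fin in \<open>auto simp: I_def\<close>)
      also have "\<dots> \<le> (\<Sum>j\<in>I. eps\<^sup>2 * (r x \<bullet> E j)\<^sup>2)"
      proof (rule sum_mono)
        fix j assume j: "j \<in> I"
        show "ev j * ((r x \<bullet> E j) * (r x \<bullet> E j)) \<le> eps\<^sup>2 * (r x \<bullet> E j)\<^sup>2"
        proof (cases "j \<in> A")
          case True
          then show ?thesis using res(1)[of j x] by (simp add: r_def)
        next
          case False
          moreover have "j \<in> {1..d} \<rightarrow>\<^sub>E {1..}" using j sub unfolding I_def by blast
          ultimately have "ev j \<le> eps\<^sup>2" unfolding A_def large_indices_def by (simp add: not_less)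
          then show ?thesis by (simp add: power2_eq_square[of "r x \<bullet> E j"] mult_right_mono)
        qed
      qed
      also have "\<dots> = eps\<^sup>2 * (\<Sum>j\<in>I. (r x \<bullet> E j)\<^sup>2)" by (simp add: sum_distrib_left)
      also have "\<dots> \<le> eps\<^sup>2 * (norm (r x))\<^sup>2"
      proof (intro mult_left_mono orthonormal_residual(2))
        show "finite I" using fin by (simp add: I_def)
        show "E i \<bullet> E j = (if i = j then 1 else 0)" if "i \<in> I" "j \<in> I" for i j
          using that sub by (intro E_inner) (auto simp: I_def)
      qed simp
      finally show ?thesis .
    qed
    then have "Sd (r x) \<bullet> Sd (r x) \<le> eps\<^sup>2 * (norm (r x))\<^sup>2"
      using Sd_inner_tendsto[OF r r] by (intro LIMSEQ_le_const2) auto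
    also have "\<dots> \<le> eps\<^sup>2 * (norm x)\<^sup>2"
      unfolding r_def by (intro mult_left_mono power_mono res(3)) auto
    also have "\<dots> = (eps * norm x)\<^sup>2" by (simp add: power_mult_distrib)
    finally show ?thesis
      using eps by (simp add: power2_norm_eq_inner[symmetric] power2_le_iff_abs_le)
  qed
  have "norm (Sd (r x)) - eps * norm x \<le> 0"
  proof (rule continuous_le_on_closure[where f = "\<lambda>x. norm (Sd (r x)) - eps * norm x"])
    show "continuous_on (closure (span (range tau))) (\<lambda>x. norm (Sd (r x)) - eps * norm x)"
      unfolding r_def by (intro continuous_intros Sd.continuous_on)
    show "x \<in> closure (span (range tau))"
      using assms tensor_H by (simp add: hilbert_tensor_power_def)
  qed (rule span_case)
  then show ?thesis by (simp add: r_def)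
qed

text \<open>The algorithm measures the coefficients \<open>x \<bullet> E j\<close>,
  \<open>j \<in> A\<close>, and applies \<open>Sd\<close> to the truncated expansion.\<close>

lemma minimal_error_card_A: "minimal_error H G Sd (card A) \<le> ereal eps"
\<comment> \<open>The error for \<open>n = 0\<close> is the norm of \<open>Sd\<close> and is defined
  without algorithms, so it needs a separate argument.\<close>
proof (cases "card A = 0")
  case True
  then have "A = {}" using finite_A by simp
  then have "norm (Sd x) \<le> eps" if "x \<in> H" "norm x \<le> 1" for x
  proof -
    have "norm (Sd x) \<le> eps * norm x"
      using truncation_error[OF that(1)] \<open>A = {}\<close> by simp
    also have "\<dots> \<le> eps * 1"
      using that(2) eps by (intro mult_left_mono) auto
    finally show ?thesis by simp
  qed
  then show ?thesis using True by (auto simp: minimal_error_def intro!: SUP_least)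
next
  case False
  define N where "N = card A"
  obtain h where h: "bij_betw h {1..N} A"
    using ex_bij_betw_nat_finite_1[OF finite_A] by (auto simp: N_def)
  define L where "L i x = x \<bullet> E (h i)" for i x
  \<comment> \<open>Functionals are numbered from 1 but list positions from 0, hence
    \<open>y ! (i - 1)\<close>.\<close>
  define phi where "phi y = (\<Sum>i=1..N. (y ! (i - 1)) *\<^sub>R Sd (E (h i)))" for y
  define alg where "alg = (\<lambda>f. phi (map (\<lambda>i. L i f) [1..<Suc N]))"
  have alg: "alg x = Sd (\<Sum>j\<in>A. (x \<bullet> E j) *\<^sub>R E j)" for x
  proof -
    have "alg x = (\<Sum>i=1..N. L i x *\<^sub>R Sd (E (h i)))"
      unfolding alg_def phi_def by (intro sum.cong) (auto simp del: upt_Suc)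
    also have "\<dots> = (\<Sum>j\<in>A. (x \<bullet> E j) *\<^sub>R Sd (E j))"
      unfolding L_def by (rule sum.reindex_bij_betw[OF h])
    finally show ?thesis by (simp add: Sd.sum Sd.scaleR)
  qed
  have "alg \<in> algorithms N G"
    unfolding algorithms_def mem_Collect_eq
  proof (intro exI conjI)
    show "\<forall>i\<in>{1..N}. bounded_linear (L i)"
      unfolding L_def by (auto intro: bounded_linear_inner_left)
    show "\<forall>y. length y = N \<longrightarrow> phi y \<in> G"
      unfolding phi_def by (auto intro!: subspace_sum subspace_scale subspace_G Sd_E_in_G)
  qed (rule alg_def)
  moreover have "(SUP f\<in>{f\<in>H. norm f \<le> 1}. ereal (norm (Sd f - alg f))) \<le> ereal eps"
  proof (rule SUP_least)
    fix f assume f: "f \<in> {f\<in>H. norm f \<le> 1}"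
    then have "norm (Sd f - alg f) \<le> eps * norm f"
      using truncation_error[of f] by (simp add: alg Sd.diff)
    also have "\<dots> \<le> eps * 1" using f eps by (intro mult_left_mono) auto
    finally show "ereal (norm (Sd f - alg f)) \<le> ereal eps" by simp
  qed
  ultimately have "(INF A\<in>algorithms N G. SUP f\<in>{f\<in>H. norm f \<le> 1}. ereal (norm (Sd f - A f))) \<le> ereal eps"
    by (intro INF_lower2[of alg])
  then show ?thesis using False by (simp add: minimal_error_def N_def)
qed

text \<open>If all \<open>L i\<close> vanish at \<open>f\<close>, an algorithm cannot distinguish \<open>f\<close> from \<open>-f\<close>.\<close>

lemma minimal_error_less_card_A:
  assumes "n < card A"
  shows "ereal eps < minimal_error H G Sd n"
proof -
  have "A \<noteq> {}" using assms by auto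
  \<comment> \<open>The minimum over the finite set \<open>A\<close> leaves a gap between
    \<open>eps\<close> and \<open>sqrt \<mu>\<close>, so the strict inequality survives the infimum
    over algorithms.\<close>
  define \<mu> where "\<mu> = Min (ev ` A)"
  have \<mu>: "eps\<^sup>2 < \<mu>" "\<And>j. j \<in> A \<Longrightarrow> \<mu> \<le> ev j"
    using finite_A \<open>A \<noteq> {}\<close> A_D(2) by (auto simp: \<mu>_def)
  have eps_less: "eps < sqrt \<mu>" using \<mu>(1) by (rule real_less_rsqrt)
  have witness: "\<exists>f\<in>H. norm f = 1 \<and> sqrt \<mu> \<le> norm (Sd f) \<and> (\<forall>i\<in>{1..n}. L i f = 0)"
    if L: "\<forall>i\<in>{1..n}. bounded_linear (L i)" for L :: "nat \<Rightarrow> 'hd \<Rightarrow> real"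
  proof -
    \<comment> \<open>There are more tensors \<open>E a\<close> than functionals, so some nonzero
      combination of them is annihilated by all \<open>L i\<close>.\<close>
    obtain c where c: "\<exists>a\<in>A. c a \<noteq> 0" "\<forall>i\<in>{1..n}. (\<Sum>a\<in>A. c a * L i (E a)) = 0"
      using exists_nontrivial_relation[OF finite_A assms, of "\<lambda>i a. L i (E a)"] by blast
    define f where "f = (\<Sum>j\<in>A. c j *\<^sub>R E j)"
    have fH: "f \<in> H" unfolding f_def by (intro subspace_sum subspace_scale subspace_H E_in_H)
    have nf: "(norm f)\<^sup>2 = (\<Sum>j\<in>A. (c j)\<^sup>2)"
      unfolding f_def using orthogonal_sum_power2_norm[OF finite_A, of E "\<lambda>_. 1"] E_inner_A by auto
    have "(\<Sum>j\<in>A. (c j)\<^sup>2) > 0"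
      using c(1) finite_A by (auto intro!: sum_pos2)
    then have f0: "norm f > 0" using nf by (metis norm_eq_zero order_less_irrefl zero_less_norm_iff zero_power2)
    have "\<mu> * (norm f)\<^sup>2 \<le> (\<Sum>j\<in>A. (c j)\<^sup>2 * ev j)"
      unfolding nf sum_distrib_left using \<mu>(2) by (intro sum_mono) (simp add: mult.commute[of _ "ev _"] mult_right_mono)
    also have "\<dots> = (norm (Sd f))\<^sup>2"
      unfolding f_def Sd.sum Sd.scaleR
      by (rule orthogonal_sum_power2_norm[OF finite_A, symmetric]) (intro Sd_E_inner A_D)
    also have "\<mu> * (norm f)\<^sup>2 = (sqrt \<mu> * norm f)\<^sup>2"
      using order_less_imp_le[OF order_le_less_trans[OF zero_le_power2 \<mu>(1)]] by (simp add: power_mult_distrib)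
    finally have Sf: "sqrt \<mu> * norm f \<le> norm (Sd f)"
      by (rule power2_le_imp_le) simp
    have Lf: "L i f = 0" if "i \<in> {1..n}" for i
    proof -
      interpret L: bounded_linear "L i" using L that by blast
      show ?thesis using c(2) that by (simp add: f_def L.sum L.scaleR)
    qed
    show ?thesis
    proof (intro bexI conjI ballI)
      let ?g = "(1 / norm f) *\<^sub>R f"
      show "?g \<in> H" using fH by (intro subspace_scale subspace_H)
      show "norm ?g = 1" using f0 by simp
      show "sqrt \<mu> \<le> norm (Sd ?g)" using Sf f0 by (simp add: Sd.scaleR field_simps)
      show "L i ?g = 0" if "i \<in> {1..n}" for i
        using Lf[OF that] L that by (simp add: linear_simps)
    qed
  qed
  have "ereal (sqrt \<mu>) \<le> minimal_error H G Sd n"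
  proof (cases "n = 0")
    case True
    then obtain f where "f \<in> H" "norm f = 1" "sqrt \<mu> \<le> norm (Sd f)"
      using witness[of "\<lambda>_ _. 0"] by auto
    then show ?thesis
      using True by (auto simp: minimal_error_def intro!: SUP_upper2[of f])
  next
    case False
    have "ereal (sqrt \<mu>) \<le> (SUP f\<in>{f\<in>H. norm f \<le> 1}. ereal (norm (Sd f - B f)))"
      if B_alg: "B \<in> algorithms n G" for B
    proof -
      obtain L :: "nat \<Rightarrow> 'hd \<Rightarrow> real" and phi :: "real list \<Rightarrow> 'gd" where L: "\<forall>i\<in>{1..n}. bounded_linear (L i)"
        and B: "B = (\<lambda>f. phi (map (\<lambda>i. L i f) [1..<Suc n]))"
        using B_alg unfolding algorithms_def by blast
      obtain f where f: "f \<in> H" "norm f = 1" "sqrt \<mu> \<le> norm (Sd f)" "\<forall>i\<in>{1..n}. L i f = 0"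
        using witness[OF L] by blast
      have "map (\<lambda>i. L i (- f)) [1..<Suc n] = map (\<lambda>i. L i f) [1..<Suc n]"
        using L f(4) by (intro map_cong) (auto simp: linear_simps less_Suc_eq_le)
      then have "B (- f) = B f" unfolding B by (rule arg_cong[where f = phi])
      then have "(Sd f - B f) - (Sd (- f) - B (- f)) = 2 *\<^sub>R Sd f"
        by (simp add: Sd.neg scaleR_2)
      then have "2 * sqrt \<mu> \<le> norm ((Sd f - B f) - (Sd (- f) - B (- f)))"
        using f(3) by simp
      also have "\<dots> \<le> norm (Sd f - B f) + norm (Sd (- f) - B (- f))"
        by (rule norm_triangle_ineq4)
      finally have "sqrt \<mu> \<le> norm (Sd f - B f) \<or> sqrt \<mu> \<le> norm (Sd (- f) - B (- f))"
        by linarith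
      then obtain g where g: "g \<in> {f, - f}" "sqrt \<mu> \<le> norm (Sd g - B g)"
        by blast
      moreover have "- f \<in> H" using f(1) subspace_H subspace_neg by blast
      ultimately show ?thesis
        using f by (intro SUP_upper2[of g]) auto
    qed
    then show ?thesis using False by (auto simp: minimal_error_def intro!: INF_greatest)
  qed
  then show ?thesis using eps_less by (meson ereal_less_eq(3) less_ereal.simps(1) order_less_le_trans)
qed

end

lemma n_ABS_eq_card:
  assumes "0 < eps"
  shows "n_ABS H G Sd eps = card (large_indices lam d (eps\<^sup>2))"
  unfolding n_ABS_def
proof (rule Least_equality)
  show "minimal_error H G Sd (card (large_indices lam d (eps\<^sup>2))) \<le> ereal eps"
    by (rule minimal_error_card_A[OF assms])
  show "card (large_indices lam d (eps\<^sup>2)) \<le> n" if "minimal_error H G Sd n \<le> ereal eps" for n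
    using minimal_error_less_card_A[OF assms, of n] that by (meson leD leI)
qed

end

section \<open>Counting large eigenvalues\<close>

text \<open>In \<open>a i powr t = a i * a i powr (t - 1)\<close> the second factor is at most the
  same power of the whole sum.\<close>

lemma sum_powr_le:
  fixes a :: "'i \<Rightarrow> real"
  assumes "finite I" "\<And>i. i \<in> I \<Longrightarrow> 0 \<le> a i" "1 \<le> t"
  shows "(\<Sum>i\<in>I. a i powr t) \<le> (\<Sum>i\<in>I. a i) powr t"
proof -
  define s where "s = (\<Sum>i\<in>I. a i)"
  have s: "0 \<le> s" "\<And>i. i \<in> I \<Longrightarrow> a i \<le> s"
    using assms by (auto simp: s_def intro: sum_nonneg member_le_sum)
  have "(\<Sum>i\<in>I. a i powr t) = (\<Sum>i\<in>I. a i * a i powr (t - 1))"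
    using assms(2) by (intro sum.cong) (simp_all add: powr_mult_base)
  also have "\<dots> \<le> (\<Sum>i\<in>I. a i * s powr (t - 1))"
    using assms(2,3) s(2) by (intro sum_mono mult_left_mono powr_mono2) auto
  also have "\<dots> = s * s powr (t - 1)"
    by (simp add: s_def sum_distrib_right)
  also have "\<dots> = s powr t" using s(1) by (simp add: powr_mult_base)
  finally show ?thesis by (simp add: s_def)
qed

lemma powr_add_le:
  fixes a b t :: real
  assumes "0 \<le> a" "0 \<le> b" "0 \<le> t"
  shows "(a + b) powr t \<le> 2 powr t * (a powr t + b powr t)"
proof -
  have "(a + b) powr t \<le> (2 * max a b) powr t"
    using assms by (intro powr_mono2) auto
  also have "\<dots> = 2 powr t * max a b powr t" using assms by (simp add: powr_mult)
  also have "\<dots> \<le> 2 powr t * (a powr t + b powr t)"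
    by (intro mult_left_mono) (auto simp: max_def)
  finally show ?thesis .
qed

text \<open>The quotient is nonnegative and its denominator positive, so convergence to 0 is a
  one-sided bound for all pairs with \<open>1 / eps + d\<close> large. The passage to a non-strict
  bound costs a factor 2 in \<open>\<eta>\<close>.\<close>

lemma weak_tractability_limit_iff:
  fixes N :: "real \<Rightarrow> nat \<Rightarrow> nat" and s t :: real
  shows "((\<lambda>(eps, d). ln (real (N eps d)) / ((1 / eps) powr s + real d powr t)) \<longlongrightarrow> 0)
      (inf (filtercomap (\<lambda>(eps, d). 1 / eps + real d) at_top) (principal ({0<..<1} \<times> {1..})))
    \<longleftrightarrow> (\<forall>\<eta>>0. \<exists>X. \<forall>eps d. 0 < eps \<and> eps < 1 \<and> 1 \<le> d \<and> X \<le> 1 / eps + real d \<longrightarrow>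
          ln (real (N eps d)) \<le> \<eta> * ((1 / eps) powr s + real d powr t))"
    (is "(?f \<longlongrightarrow> 0) ?F \<longleftrightarrow> ?R")
proof -
  have ev: "eventually P ?F \<longleftrightarrow>
    (\<exists>X. \<forall>eps d. 0 < eps \<and> eps < 1 \<and> 1 \<le> d \<and> X \<le> 1 / eps + real d \<longrightarrow> P (eps, d))" for P
  proof -
    have "eventually P ?F \<longleftrightarrow>
      (\<exists>Q. eventually Q at_top \<and> (\<forall>eps d. Q (1 / eps + real d) \<longrightarrow> 0 < eps \<and> eps < 1 \<and> 1 \<le> d \<longrightarrow> P (eps, d)))"
      by (auto simp: eventually_inf_principal eventually_filtercomap)
    also have "\<dots> \<longleftrightarrow> (\<exists>X. \<forall>eps d. 0 < eps \<and> eps < 1 \<and> 1 \<le> d \<and> X \<le> 1 / eps + real d \<longrightarrow> P (eps, d))"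
      (is "?A \<longleftrightarrow> ?B")
    proof
      assume ?A
      then obtain Q X where "\<And>x. X \<le> x \<Longrightarrow> Q x"
        "\<And>eps d. Q (1 / eps + real d) \<Longrightarrow> 0 < eps \<and> eps < 1 \<and> 1 \<le> d \<Longrightarrow> P (eps, d)"
        unfolding eventually_at_top_linorder by blast
      then show ?B by blast
    next
      assume ?B
      then obtain X where "\<And>eps d. 0 < eps \<and> eps < 1 \<and> 1 \<le> d \<and> X \<le> 1 / eps + real d \<Longrightarrow> P (eps, d)"
        by blast
      then show ?A
        by (intro exI[of _ "\<lambda>x. X \<le> x"] conjI eventually_ge_at_top) blast
    qed
    finally show ?thesis .
  qed
  \<comment> \<open>For \<open>n = 0\<close> this rests on the convention
    \<open>ln 0 = 0\<close>.\<close>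
  have ln_nonneg: "0 \<le> ln (real n)" for n :: nat by (cases "n = 0") auto
  have abs_eq: "\<bar>?f (eps, d)\<bar> = ln (real (N eps d)) / ((1 / eps) powr s + real d powr t)" for eps d
    using ln_nonneg[of "N eps d"] by (simp add: abs_of_nonneg add_nonneg_nonneg)
  have pos: "(1 / eps) powr s + real d powr t > 0" if "0 < eps" for eps :: real and d
    using that by (intro add_pos_nonneg) auto
  show ?thesis
  proof
    assume L: "(?f \<longlongrightarrow> 0) ?F"
    show ?R
    proof (intro allI impI)
      fix \<eta> :: real assume "\<eta> > 0"
      then have "eventually (\<lambda>x. \<bar>?f x\<bar> < \<eta>) ?F"
        using tendstoD[OF L] by (simp add: dist_real_def)
      then obtain X where X: "\<And>eps d. 0 < eps \<and> eps < 1 \<and> 1 \<le> d \<and> X \<le> 1 / eps + real d \<Longrightarrow>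
          ln (real (N eps d)) / ((1 / eps) powr s + real d powr t) < \<eta>"
        unfolding ev abs_eq by blast
      show "\<exists>X. \<forall>eps d. 0 < eps \<and> eps < 1 \<and> 1 \<le> d \<and> X \<le> 1 / eps + real d \<longrightarrow>
          ln (real (N eps d)) \<le> \<eta> * ((1 / eps) powr s + real d powr t)"
        using X pos by (intro exI[of _ X] allI impI) (simp add: pos_divide_less_eq less_imp_le)
    qed
  next
    assume R: ?R
    show "(?f \<longlongrightarrow> 0) ?F"
    proof (rule tendstoI)
      fix \<eta> :: real assume "\<eta> > 0"
      then obtain X where X: "\<And>eps d. 0 < eps \<and> eps < 1 \<and> 1 \<le> d \<and> X \<le> 1 / eps + real d \<Longrightarrow>
          ln (real (N eps d)) \<le> \<eta> / 2 * ((1 / eps) powr s + real d powr t)"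
        using R[rule_format, of "\<eta> / 2"] by auto
      have "\<bar>?f (eps, d)\<bar> < \<eta>" if "0 < eps \<and> eps < 1 \<and> 1 \<le> d \<and> X \<le> 1 / eps + real d" for eps d
      proof -
        have "\<bar>?f (eps, d)\<bar> \<le> \<eta> / 2"
          unfolding abs_eq using X[OF that] pos[of eps d] that by (simp add: pos_divide_le_eq)
        also have "\<eta> / 2 < \<eta>" using \<open>\<eta> > 0\<close> by simp
        finally show ?thesis .
      qed
      then have "eventually (\<lambda>x. \<bar>?f x\<bar> < \<eta>) ?F"
        unfolding ev by blast
      then show "eventually (\<lambda>x. dist (?f x) 0 < \<eta>) ?F"
        by (simp add: dist_real_def)
    qed
  qed
qed

section \<open>Lower and upper bounds for the number of large eigenvalues\<close>

locale nontrivial_eigenvalue_sequence = eigenvalue_sequence +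
  assumes lam2: "0 < lam 2" and lam1: "1 < lam 1"
begin

lemma lam_le_lam1: "1 \<le> j \<Longrightarrow> lam j \<le> lam 1"
  using decr[of 1 j] by simp

text \<open>Choose \<open>m\<close> with \<open>lam 2 * lam 1 ^ m \<ge> 1\<close>, so that each
  entry 2 is compensated by \<open>m\<close> entries 1. With \<open>M = Suc m\<close>, every subset
  of the first \<open>d div M\<close> coordinates may carry the entry 2 while the eigenvalue stays
  at least 1.\<close>

lemma card_large_indices_exponential:
  obtains M where "0 < M" "\<And>d x. 0 < x \<Longrightarrow> x < 1 \<Longrightarrow> 2 ^ (d div M) \<le> card (large_indices lam d x)"
proof -
  obtain m where "1 / lam 2 < lam 1 ^ m"
    using real_arch_pow[OF lam1] by blast
  then have m: "1 \<le> lam 2 * lam 1 ^ m"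
    using lam2 by (simp add: field_simps)
  have "2 ^ (d div Suc m) \<le> card (large_indices lam d x)" if x: "0 < x" "x < 1" for d x
  proof -
    define q where "q = d div Suc m"
    define f where "f B = (\<lambda>k\<in>{1..d}. if k \<in> B then 2 else 1 :: nat)" for B
    have "q \<le> d" by (simp add: q_def)
    have f_large: "f B \<in> large_indices lam d x" if B: "B \<subseteq> {1..q}" for B
    proof -
      have BD: "B \<subseteq> {1..d}" using B \<open>q \<le> d\<close> by auto
      have "card B \<le> q" using card_mono[OF _ B] by simp
      then have "Suc m * card B \<le> Suc m * q" by (intro mult_le_mono) auto
      also have "\<dots> \<le> d" unfolding q_def by (rule times_div_less_eq_dividend)
      finally have le: "card B + m * card B \<le> d" by simp
      have "tensor_eigenvalue lam d (f B) = (\<Prod>k\<in>{1..d}. if k \<in> B then lam 2 else lam 1)"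
        unfolding tensor_eigenvalue_def f_def by (intro prod.cong) auto
      also have "\<dots> = (\<Prod>k\<in>B. lam 2) * (\<Prod>k\<in>{1..d} - B. lam 1)"
        using BD by (subst prod.If_cases) (auto simp: Int_absorb1 Diff_eq)
      also have "\<dots> = lam 2 ^ card B * lam 1 ^ (d - card B)"
        using BD by (simp add: card_Diff_subset finite_subset)
      \<comment> \<open>The ones are split into \<open>m\<close> for each two and a remainder, whose
        contribution is at least 1.\<close>
      also have "d - card B = m * card B + (d - card B - m * card B)"
        using le by simp
      also have "lam 2 ^ card B * lam 1 ^ (m * card B + (d - card B - m * card B))
        = (lam 2 * lam 1 ^ m) ^ card B * lam 1 ^ (d - card B - m * card B)"
        by (simp add: power_add power_mult power_mult_distrib)
      also have "\<dots> \<ge> 1 * 1"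
        using m lam1 by (intro mult_mono one_le_power) auto
      finally have "x < tensor_eigenvalue lam d (f B)" using x by simp
      moreover have "f B \<in> {1..d} \<rightarrow>\<^sub>E {1..}" by (auto simp: f_def)
      ultimately show ?thesis by (simp add: large_indices_def)
    qed
    have "inj_on f (Pow {1..q})"
    proof (rule inj_onI)
      fix B C assume BC: "B \<in> Pow {1..q}" "C \<in> Pow {1..q}" "f B = f C"
      have "B = {k \<in> {1..d}. f B k = 2}" if "B \<in> Pow {1..q}" for B
        using that \<open>q \<le> d\<close> by (auto simp: f_def split: if_splits)
      then show "B = C" using BC by metis
    qed
    then have "card (Pow {1..q}) \<le> card (large_indices lam d x)"
      using f_large finite_large_indices[OF x(1)] by (intro card_inj_on_le[of f]) auto
    then show ?thesis by (simp add: card_Pow q_def)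
  qed
  then show ?thesis using that[of "Suc m"] by blast
qed

lemma card_large_indices_ge:
  assumes "0 < x" "x < 1" "1 \<le> d" "1 \<le> lam 1 ^ (d - 1) * lam J"
  shows "J \<le> card (large_indices lam d x)"
proof -
  define f where "f j = (\<lambda>k\<in>{1..d}. if k = 1 then j else 1 :: nat)" for j
  have f_large: "f j \<in> large_indices lam d x" if j: "j \<in> {1..J}" for j
  proof -
    have "tensor_eigenvalue lam d (f j) = lam (f j 1) * (\<Prod>k\<in>{1..d} - {1}. lam (f j k))"
      unfolding tensor_eigenvalue_def using assms(3) by (intro prod.remove) auto
    also have "(\<Prod>k\<in>{1..d} - {1}. lam (f j k)) = (\<Prod>k\<in>{1..d} - {1}. lam 1)"
      by (intro prod.cong) (auto simp: f_def)
    also have "lam (f j 1) = lam j" using assms(3) by (simp add: f_def)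
    also have "(\<Prod>k\<in>{1..d} - {1}. lam 1) = lam 1 ^ (d - 1)" using assms(3) by simp
    also have "lam j * lam 1 ^ (d - 1) \<ge> lam J * lam 1 ^ (d - 1)"
      using j lam1 by (intro mult_right_mono decr) auto
    finally have "x < tensor_eigenvalue lam d (f j)"
      using assms by (simp add: mult.commute)
    moreover have "f j \<in> {1..d} \<rightarrow>\<^sub>E {1..}" using j by (auto simp: f_def)
    ultimately show ?thesis by (simp add: large_indices_def)
  qed
  have "inj_on f {1..J}"
  proof (rule inj_onI)
    fix i j assume "f i = f j"
    then have "f i 1 = f j 1" by simp
    then show "i = j" using assms(3) by (simp add: f_def)
  qed
  then have "card {1..J} \<le> card (large_indices lam d x)"
    using f_large finite_large_indices[OF assms(1)] by (intro card_inj_on_le[of f]) auto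
  then show ?thesis by simp
qed

text \<open>A large index satisfies \<open>(\<Sum>k. b k) \<le> R\<close> with \<open>b k = ln (lam 1 / lam (j k))\<close>, so
  \<open>exp (\<delta> R\<^sup>t) * (\<Prod>k. exp (-\<delta> (b k)\<^sup>t)) \<ge> 1\<close> by superadditivity of \<open>x\<^sup>t\<close>. Summing these products over
  all indices gives a \<open>d\<close>-th power of a series, which converges by the growth of \<open>ln (1 / lam j)\<close>.\<close>

lemma card_large_indices_le:
  assumes "1 \<le> t" "0 < \<delta>" and lim: "(\<lambda>j. log_ratio t (lam j) j) \<longlonglongrightarrow> \<infinity>"
  obtains C where "1 \<le> C" "\<And>d x. 0 < x \<Longrightarrow> x \<le> 1 \<Longrightarrow>
    real (card (large_indices lam d x)) \<le> C ^ d * exp (\<delta> * (ln (1 / x) + real d * ln (lam 1)) powr t)"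
proof -
  define b where "b j = ln (lam 1 / lam j)" for j
  \<comment> \<open>Indices with \<open>lam j = 0\<close> get weight 0; they never occur in a tuple
    with positive eigenvalue.\<close>
  define w where "w j = (if 1 \<le> j \<and> 0 < lam j then exp (- \<delta> * b j powr t) else 0)" for j
  have b_nonneg: "0 \<le> b j" if "1 \<le> j" "0 < lam j" for j
    using that lam_le_lam1[of j] by (simp add: b_def)
  have w_nonneg: "0 \<le> w j" for j by (simp add: w_def)
  have "eventually (\<lambda>j. norm (w j) \<le> inverse (real j ^ 2)) sequentially"
  proof -
    \<comment> \<open>The threshold \<open>2 / \<delta>\<close> is chosen so that the weight of
      \<open>j\<close> is at most \<open>j\<close> to the power -2, which is summable.\<close>
    have "eventually (\<lambda>j. ereal (2 / \<delta>) < log_ratio t (lam j) j) sequentially"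
      using lim by (simp add: tendsto_PInfty)
    moreover have "eventually (\<lambda>j. lam j < 1) sequentially"
      by (rule order_tendstoD(2)[OF lam_tendsto]) simp
    moreover have "eventually (\<lambda>j::nat. 2 \<le> j) sequentially" by (rule eventually_ge_at_top)
    ultimately show ?thesis
    proof eventually_elim
      case (elim j)
      show ?case
      proof (cases "0 < lam j")
        case True
        have lnj: "0 < ln (real j)" using elim by simp
        have "2 / \<delta> < ln (1 / lam j) powr t / ln (real j)"
          using elim True by (simp add: log_ratio_def)
        then have "2 * ln (real j) \<le> \<delta> * ln (1 / lam j) powr t"
          using lnj \<open>0 < \<delta>\<close> by (simp add: field_simps)
        also have "\<dots> \<le> \<delta> * b j powr t"
        proof -
          have "ln (1 / lam j) \<le> b j"
            unfolding b_def using True lam1 by (intro ln_mono) (auto simp: divide_right_mono)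
          moreover have "0 \<le> ln (1 / lam j)" using True elim by simp
          ultimately show ?thesis using assms by (intro mult_left_mono powr_mono2) auto
        qed
        finally have "w j \<le> exp (- (2 * ln (real j)))"
          using elim True by (simp add: w_def)
        also have "\<dots> = inverse (exp (ln (real j)) ^ 2)"
          by (simp add: exp_minus exp_double)
        also have "\<dots> = inverse (real j ^ 2)" using elim by simp
        finally show ?thesis using w_nonneg[of j] by simp
      qed (simp add: w_def)
    qed
  qed
  then have sw: "summable w"
    by (rule summable_comparison_test_ev) (rule inverse_power_summable, simp)
  \<comment> \<open>Adding 1 makes \<open>C \<ge> 1\<close>, so that \<open>ln C\<close> is
    nonnegative when the bound is used.\<close>
  define C where "C = 1 + suminf w"
  have C1: "1 \<le> C" using suminf_nonneg[OF sw w_nonneg] by (simp add: C_def)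
  have main: "real (card (large_indices lam d x)) \<le> C ^ d * exp (\<delta> * (ln (1 / x) + real d * ln (lam 1)) powr t)"
    if x: "0 < x" "x \<le> 1" for d x
  proof -
    define R where "R = ln (1 / x) + real d * ln (lam 1)"
    obtain m where m: "large_indices lam d x \<subseteq> {1..d} \<rightarrow>\<^sub>E {1..m}"
      using large_indices_bounded[OF x(1)] by metis
    have fin: "finite ({1..d} \<rightarrow>\<^sub>E {1..m})" by (intro finite_PiE) auto
    have weight: "1 \<le> exp (\<delta> * R powr t) * (\<Prod>k=1..d. w (j k))" if j: "j \<in> large_indices lam d x" for j
    proof -
      have jP: "j \<in> {1..d} \<rightarrow>\<^sub>E {1..}" and xj: "x < tensor_eigenvalue lam d j"
        using j by (auto simp: large_indices_def)
      have pos: "1 \<le> j k" "0 < lam (j k)" if "k \<in> {1..d}" for k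
        using jP that tensor_eigenvalue_posD[OF jP _ that] xj x by auto
      have "(\<Sum>k=1..d. b (j k)) = (\<Sum>k=1..d. ln (lam 1) - ln (lam (j k)))"
      proof (intro sum.cong refl)
        show "b (j k) = ln (lam 1) - ln (lam (j k))" if "k \<in> {1..d}" for k
          using pos[OF that] lam1 by (simp add: b_def ln_div)
      qed
      also have "\<dots> = real d * ln (lam 1) - ln (tensor_eigenvalue lam d j)"
      proof -
        have "ln (tensor_eigenvalue lam d j) = (\<Sum>k=1..d. ln (lam (j k)))"
          unfolding tensor_eigenvalue_def by (intro ln_prod less_imp_neq[THEN not_sym] pos) auto
        then show ?thesis by (simp add: sum_subtractf)
      qed
      also have "\<dots> \<le> R"
        using xj x by (simp add: R_def ln_div)
      finally have sum_b: "(\<Sum>k=1..d. b (j k)) \<le> R" .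
      have "(\<Sum>k=1..d. b (j k) powr t) \<le> (\<Sum>k=1..d. b (j k)) powr t"
        using pos b_nonneg assms(1) by (intro sum_powr_le) auto
      also have "\<dots> \<le> R powr t"
        using sum_b assms(1) pos b_nonneg by (intro powr_mono2 sum_nonneg) auto
      finally have "\<delta> * (\<Sum>k=1..d. b (j k) powr t) \<le> \<delta> * R powr t"
        using assms(2) by (intro mult_left_mono) auto
      moreover have "(\<Prod>k=1..d. w (j k)) = exp (- (\<delta> * (\<Sum>k=1..d. b (j k) powr t)))"
        using pos by (simp add: w_def exp_sum sum_distrib_left flip: sum_negf)
      ultimately show ?thesis
        by (simp flip: exp_add)
    qed
    have "real (card (large_indices lam d x)) = (\<Sum>j\<in>large_indices lam d x. 1)" by simp
    also have "\<dots> \<le> (\<Sum>j\<in>large_indices lam d x. exp (\<delta> * R powr t) * (\<Prod>k=1..d. w (j k)))"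
      by (intro sum_mono weight)
    also have "\<dots> \<le> (\<Sum>j\<in>{1..d} \<rightarrow>\<^sub>E {1..m}. exp (\<delta> * R powr t) * (\<Prod>k=1..d. w (j k)))"
      using m fin w_nonneg by (intro sum_mono2) (auto intro!: mult_nonneg_nonneg prod_nonneg)
    also have "\<dots> = exp (\<delta> * R powr t) * (\<Prod>k=1..d. \<Sum>i=1..m. w i)"
      by (subst prod_sum_PiE) (simp_all add: sum_distrib_left)
    also have "\<dots> \<le> exp (\<delta> * R powr t) * C ^ d"
    proof -
      have "(\<Sum>i=1..m. w i) \<le> C"
        using sum_le_suminf[OF sw, of "{1..m}"] w_nonneg by (simp add: C_def)
      then show ?thesis using w_nonneg by (auto intro!: power_mono sum_nonneg)
    qed
    finally show ?thesis by (simp add: R_def mult.commute)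
  qed
  show ?thesis by (rule that[OF C1 main])
qed

section \<open>Necessity of the two conditions\<close>

lemma tractable_imp_t_gt_1:
  assumes "0 < t"
    and tract: "\<forall>\<eta>>0. \<exists>X. \<forall>eps d. 0 < eps \<and> eps < 1 \<and> 1 \<le> d \<and> X \<le> 1 / eps + real d \<longrightarrow>
      ln (real (card (large_indices lam d (eps\<^sup>2)))) \<le> \<eta> * ((1 / eps) powr s + real d powr t)"
  shows "1 < t"
proof (rule ccontr)
  assume "\<not> 1 < t"
  then have "t \<le> 1" by simp
  obtain M where M: "0 < M" "\<And>d x. 0 < x \<Longrightarrow> x < 1 \<Longrightarrow> 2 ^ (d div M) \<le> card (large_indices lam d x)"
    using card_large_indices_exponential by blast
  \<comment> \<open>Half of the exponential growth rate \<open>ln 2 / M\<close> of the count at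
    \<open>eps = 1/2\<close>. If \<open>t \<le> 1\<close>, the tractability bound then leaves
    \<open>d * \<eta>\<close> bounded for all large \<open>d\<close>.\<close>
  define \<eta> where "\<eta> = ln 2 / (2 * real M)"
  have "\<eta> > 0" using M by (simp add: \<eta>_def)
  then obtain X where X: "\<And>eps d. 0 < eps \<and> eps < 1 \<and> 1 \<le> d \<and> X \<le> 1 / eps + real d \<Longrightarrow>
      ln (real (card (large_indices lam d (eps\<^sup>2)))) \<le> \<eta> * ((1 / eps) powr s + real d powr t)"
    using tract by blast
  have bound: "real d * \<eta> \<le> ln 2 + \<eta> * 2 powr s" if d: "1 \<le> d" "X \<le> real d" for d
  proof -
    have "real d / real M \<le> real (d div M) + 1"
    proof -
      have "d < M + M * (d div M)" using M(1) by (rule dividend_less_times_div)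
      then have "real d < real M + real M * real (d div M)"
        by (metis of_nat_add of_nat_less_iff of_nat_mult)
      then show ?thesis using M(1) by (simp add: pos_divide_le_eq ring_distribs mult.commute)
    qed
    then have "real d / real M * ln 2 \<le> (real (d div M) + 1) * ln 2"
      by (intro mult_right_mono) auto
    moreover have "2 * (real d * \<eta>) = real d / real M * ln 2"
      using M(1) by (simp add: \<eta>_def)
    ultimately have "2 * (real d * \<eta>) \<le> real (d div M) * ln 2 + ln 2"
      by (simp add: ring_distribs)
    also have "real (d div M) * ln 2 = ln (real (2 ^ (d div M)))"
      by (simp add: ln_realpow)
    also have "\<dots> \<le> ln (real (card (large_indices lam d ((1/2)\<^sup>2))))"
    proof -
      have "2 ^ (d div M) \<le> card (large_indices lam d ((1/2)\<^sup>2))"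
        by (rule M(2)) (auto simp: power2_eq_square)
      then have "real (2 ^ (d div M)) \<le> real (card (large_indices lam d ((1/2)\<^sup>2)))"
        by (simp only: of_nat_le_iff)
      then show ?thesis by (intro ln_mono) auto
    qed
    also have "\<dots> \<le> \<eta> * ((1 / (1/2)) powr s + real d powr t)"
      by (rule X) (use d in auto)
    also have "\<dots> \<le> \<eta> * (2 powr s + real d powr 1)"
      using \<open>\<eta> > 0\<close> \<open>t \<le> 1\<close> d by (intro mult_left_mono add_mono powr_mono) auto
    also have "\<dots> = \<eta> * 2 powr s + real d * \<eta>"
      by (simp add: ring_distribs)
    finally show ?thesis by linarith
  qed
  obtain d :: nat where d: "max 1 (max X ((ln 2 + \<eta> * 2 powr s) / \<eta>)) < real d"
    using reals_Archimedean2 by blast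
  then have "1 \<le> d" "X \<le> real d" "(ln 2 + \<eta> * 2 powr s) / \<eta> < real d" by auto
  then show False
    using bound[of d] \<open>\<eta> > 0\<close> by (simp add: pos_divide_less_eq)
qed

lemma tractable_imp_log_ratio:
  assumes "0 < t"
    and tract: "\<forall>\<eta>>0. \<exists>X. \<forall>eps d. 0 < eps \<and> eps < 1 \<and> 1 \<le> d \<and> X \<le> 1 / eps + real d \<longrightarrow>
      ln (real (card (large_indices lam d (eps\<^sup>2)))) \<le> \<eta> * ((1 / eps) powr s + real d powr t)"
  shows "(\<lambda>j. log_ratio t (lam j) j) \<longlonglongrightarrow> \<infinity>"
  unfolding tendsto_PInfty
proof
  fix r :: real
  define r' where "r' = max r 1"
  define L where "L = ln (lam 1)"
  have L: "L > 0" using lam1 by (simp add: L_def)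
  \<comment> \<open>Chosen so that the dimension \<open>d \<le> a / L + 2\<close> used below
    satisfies \<open>d \<le> \<kappa> * a\<close> whenever \<open>a \<ge> 1\<close>.\<close>
  define \<kappa> where "\<kappa> = 1 / L + 2"
  have \<kappa>: "0 < \<kappa>" using L by (simp add: \<kappa>_def add_pos_pos)
  \<comment> \<open>With this value the tractability bound at \<open>eps = 1/2\<close> becomes
    \<open>ln J \<le> a powr t / (2 * r')\<close>.\<close>
  define \<eta> where "\<eta> = 1 / (2 * r' * (2 powr s + \<kappa> powr t))"
  have r': "r' > 0" "r \<le> r'" by (auto simp: r'_def)
  have \<kappa>0: "2 powr s + \<kappa> powr t > 0" by (intro add_pos_nonneg) auto
  then have "\<eta> > 0" using r' by (simp add: \<eta>_def)
  then obtain X where X: "\<And>eps d. 0 < eps \<and> eps < 1 \<and> 1 \<le> d \<and> X \<le> 1 / eps + real d \<Longrightarrow>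
      ln (real (card (large_indices lam d (eps\<^sup>2)))) \<le> \<eta> * ((1 / eps) powr s + real d powr t)"
    using tract by blast
  \<comment> \<open>This makes \<open>a = ln (1 / lam J)\<close> at least 1 and at least
    \<open>L * X\<close>; the latter puts the dimension \<open>d\<close> in the range where the
    tractability bound is valid.\<close>
  have "eventually (\<lambda>J. lam J < exp (- max 1 (L * X))) sequentially"
    by (rule order_tendstoD(2)[OF lam_tendsto]) simp
  moreover have "eventually (\<lambda>J::nat. 2 \<le> J) sequentially" by (rule eventually_ge_at_top)
  ultimately show "eventually (\<lambda>J. ereal r < log_ratio t (lam J) J) sequentially"
  proof eventually_elim
    case (elim J)
    show ?case
    proof (cases "lam J = 0")
      case False
      then have lamJ: "0 < lam J" using nonneg[of J] elim by simp
      define a where "a = ln (1 / lam J)"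
      have "ln (lam J) < - max 1 (L * X)"
        using ln_less_cancel_iff[OF lamJ, of "exp (- max 1 (L * X))"] elim by simp
      then have a: "1 \<le> a" "L * X \<le> a"
        using lamJ by (auto simp: a_def ln_div)
      \<comment> \<open>One coordinate carries the index \<open>j\<close>, and the other
        \<open>d - 1\<close> factors \<open>lam 1\<close> must compensate \<open>lam J\<close>, so
        \<open>d - 1\<close> is \<open>a / L\<close> rounded up.\<close>
      define d where "d = Suc (nat \<lceil>a / L\<rceil>)"
      have aL: "0 \<le> a / L" using a L by simp
      then have d_eq: "real (d - 1) = of_int \<lceil>a / L\<rceil>" by (simp add: d_def)
      then have d1: "a / L \<le> real (d - 1)" by linarith
      have d2: "real d \<le> a / L + 2" using d_eq by (simp add: d_def) linarith
      have "real d \<le> \<kappa> * a"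
        using d2 a(1) by (simp add: \<kappa>_def ring_distribs)
      have "1 / lam J = exp a" using lamJ by (simp add: a_def)
      also have "\<dots> \<le> exp (real (d - 1) * L)"
        using d1 L by (simp add: pos_divide_le_eq)
      also have "\<dots> = lam 1 ^ (d - 1)"
        using lam1 by (simp add: L_def exp_of_nat_mult)
      finally have "1 \<le> lam 1 ^ (d - 1) * lam J"
        using lamJ by (simp add: pos_divide_le_eq)
      then have "J \<le> card (large_indices lam d ((1/2)\<^sup>2))"
        by (intro card_large_indices_ge) (auto simp: d_def power2_eq_square)
      then have "ln (real J) \<le> ln (real (card (large_indices lam d ((1/2)\<^sup>2))))"
        using elim by (intro ln_mono) auto
      also have "\<dots> \<le> \<eta> * ((1 / (1/2)) powr s + real d powr t)"
      proof (rule X)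
        have "X \<le> a / L" using a(2) L by (simp add: pos_le_divide_eq mult.commute)
        also have "\<dots> \<le> 1 / (1/2) + real d" using d1 by simp
        finally show "0 < (1/2::real) \<and> (1/2::real) < 1 \<and> 1 \<le> d \<and> X \<le> 1 / (1/2) + real d"
          by (simp add: d_def)
      qed
      also have "\<dots> \<le> \<eta> * (2 powr s * a powr t + (\<kappa> * a) powr t)"
      proof (intro mult_left_mono add_mono)
        have "1 \<le> a powr t" using a(1) assms(1) by (simp add: ge_one_powr_ge_zero)
        then show "(1 / (1/2)) powr s \<le> 2 powr s * a powr t" by simp
        show "real d powr t \<le> (\<kappa> * a) powr t"
          using \<open>real d \<le> \<kappa> * a\<close> assms(1) by (intro powr_mono2) auto
      qed (use \<open>\<eta> > 0\<close> in auto)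
      also have "\<dots> = \<eta> * (2 powr s + \<kappa> powr t) * a powr t"
        using a(1) \<kappa> by (simp add: powr_mult algebra_simps)
      also have "\<dots> = a powr t / (2 * r')"
        using \<kappa>0 by (simp add: \<eta>_def)
      finally have "2 * r' * ln (real J) \<le> a powr t"
        using r' by (simp add: pos_le_divide_eq mult.commute)
      moreover have lnJ: "0 < ln (real J)" using elim by simp
      \<comment> \<open>The factor 2 in \<open>\<eta>\<close> turns the bound into a strict
        inequality.\<close>
      moreover have "r * ln (real J) < 2 * r' * ln (real J)"
        using r' lnJ by (intro mult_strict_right_mono) auto
      ultimately have "r < a powr t / ln (real J)"
        unfolding pos_less_divide_eq[OF lnJ] by linarith
      then show ?thesis using False by (simp add: log_ratio_def a_def)
    qed (simp add: log_ratio_def)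
  qed
qed

section \<open>Sufficiency of the two conditions\<close>

text \<open>\<open>card_large_indices_le\<close> bounds the logarithm of the count by two terms,
  each of which receives half of \<open>\<eta>\<close>. The power term is absorbed by a small
  \<open>\<delta>\<close>, the linear term \<open>d * ln C\<close> by \<open>t > 1\<close> for large
  \<open>d\<close> and by \<open>(1 / eps) powr s\<close> otherwise.\<close>

lemma log_ratio_imp_tractable:
  assumes "0 < s" "1 < t" and lim: "(\<lambda>j. log_ratio t (lam j) j) \<longlonglongrightarrow> \<infinity>" and "0 < \<eta>"
  shows "\<exists>X. \<forall>eps d. 0 < eps \<and> eps < 1 \<and> 1 \<le> d \<and> X \<le> 1 / eps + real d \<longrightarrow>
      ln (real (card (large_indices lam d (eps\<^sup>2)))) \<le> \<eta> * ((1 / eps) powr s + real d powr t)"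
proof -
  define L where "L = ln (lam 1)"
  have L: "L > 0" using lam1 by (simp add: L_def)
  \<comment> \<open>\<open>K\<close> bounds the power term:
    \<open>(2 * ln (1 / eps) + d * L) powr t\<close> is at most \<open>K\<close> times the
    denominator, which dictates \<open>\<delta> = \<eta> / (2 * K)\<close>.\<close>
  define K where "K = 2 powr t * ((2 * t / s) powr t + L powr t)"
  have K: "K > 0" using L by (simp add: K_def add_nonneg_pos)
  obtain C where C: "1 \<le> C" "\<And>d x. 0 < x \<Longrightarrow> x \<le> 1 \<Longrightarrow> real (card (large_indices lam d x))
      \<le> C ^ d * exp (\<eta> / (2 * K) * (ln (1 / x) + real d * ln (lam 1)) powr t)"
    using card_large_indices_le[of t "\<eta> / (2 * K)"] assms K by auto
  define c where "c = ln C"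
  have c: "0 \<le> c" using C by (simp add: c_def)
  \<comment> \<open>\<open>D\<close> is the dimension from which
    \<open>c \<le> \<eta> / 2 * d powr (t - 1)\<close>, and \<open>Y\<close> is the value of
    \<open>1 / eps\<close> from which
    \<open>D * c \<le> \<eta> / 2 * (1 / eps) powr s\<close>.\<close>
  define D where "D = (2 * c / \<eta>) powr (1 / (t - 1))"
  define Y where "Y = (2 * D * c / \<eta>) powr (1 / s)"
  have D: "0 \<le> D" "0 \<le> Y" by (simp_all add: D_def Y_def)
  have "ln (real (card (large_indices lam d (eps\<^sup>2)))) \<le> \<eta> * ((1 / eps) powr s + real d powr t)"
    if eps: "0 < eps" "eps < 1" and d: "1 \<le> d" and ge: "D + Y \<le> 1 / eps + real d" for eps d
  proof -
    define y where "y = 1 / eps"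
    have y: "1 \<le> y" using eps by (simp add: y_def)
    define N where "N = card (large_indices lam d (eps\<^sup>2))"
    have ln_eps: "ln (1 / eps\<^sup>2) = 2 * ln y"
      using eps by (simp add: y_def ln_div ln_realpow)
    have "(2 * ln y + real d * L) powr t \<le> 2 powr t * ((2 * ln y) powr t + (real d * L) powr t)"
      using y L assms by (intro powr_add_le) auto
    also have "\<dots> \<le> 2 powr t * ((2 * t / s) powr t * y powr s + L powr t * real d powr t)"
    proof (intro mult_left_mono add_mono)
      \<comment> \<open>The exponent \<open>s / t\<close> is chosen because its \<open>t\<close>-th
        power yields exactly \<open>y powr s\<close>.\<close>
      have "2 * ln y \<le> 2 * (y powr (s / t) / (s / t))"
        using y assms by (intro mult_left_mono ln_powr_bound) auto
      then have "(2 * ln y) powr t \<le> ((2 * t / s) * y powr (s / t)) powr t"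
        using y assms by (intro powr_mono2) (auto simp: field_simps)
      also have "\<dots> = (2 * t / s) powr t * y powr s"
        using assms by (subst powr_mult) (simp_all add: powr_powr)
      finally show "(2 * ln y) powr t \<le> (2 * t / s) powr t * y powr s" .
      show "(real d * L) powr t \<le> L powr t * real d powr t"
        using L by (simp add: powr_mult)
    qed auto
    also have "\<dots> \<le> K * (y powr s + real d powr t)"
    proof -
      have "0 \<le> 2 powr t * ((2 * t / s) powr t * real d powr t + L powr t * y powr s)"
        by simp
      then show ?thesis by (simp add: K_def ring_distribs)
    qed
    finally have R: "\<eta> / (2 * K) * (2 * ln y + real d * L) powr t \<le> \<eta> / 2 * (y powr s + real d powr t)"
    proof -
      assume le: "(2 * ln y + real d * L) powr t \<le> K * (y powr s + real d powr t)"
      have "\<eta> / (2 * K) * (2 * ln y + real d * L) powr t \<le> \<eta> / (2 * K) * (K * (y powr s + real d powr t))"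
        using K \<open>0 < \<eta>\<close> by (intro mult_left_mono le) auto
      then show ?thesis using K by simp
    qed
    have lin: "real d * c \<le> \<eta> / 2 * (y powr s + real d powr t)"
    \<comment> \<open>Since \<open>D + Y \<le> y + d\<close>, at least one of the two thresholds is
      reached.\<close>
    proof (cases "D \<le> real d")
      case True
      have "2 * c / \<eta> = D powr (t - 1)"
        using c assms by (simp add: D_def powr_powr)
      also have "\<dots> \<le> real d powr (t - 1)"
        using True D assms by (intro powr_mono2) auto
      finally have "real d * c \<le> real d * (\<eta> / 2 * real d powr (t - 1))"
        using assms by (intro mult_left_mono) (auto simp: field_simps)
      also have "\<dots> = \<eta> / 2 * real d powr t"
        using powr_mult_base[of "real d" "t - 1"] by simp
      finally show ?thesis
        using assms by (simp add: ring_distribs add_increasing)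
    next
      case False
      then have "Y \<le> y" using ge by (simp add: y_def)
      have "2 * D * c / \<eta> = Y powr s"
        using c D assms by (simp add: Y_def powr_powr)
      also have "\<dots> \<le> y powr s"
        using \<open>Y \<le> y\<close> D assms by (intro powr_mono2) auto
      finally have "D * c \<le> \<eta> / 2 * y powr s" using assms by (simp add: field_simps)
      moreover have "real d * c \<le> D * c" using False c by (intro mult_right_mono) auto
      moreover have "0 \<le> \<eta> / 2 * real d powr t" using assms by simp
      ultimately show ?thesis by (simp add: ring_distribs)
    qed
    show ?thesis
    proof (cases "N = 0")
      case True
      then show ?thesis using assms by (simp add: N_def add_nonneg_nonneg)
    next
      case False
      have "real N \<le> C ^ d * exp (\<eta> / (2 * K) * (2 * ln y + real d * L) powr t)"
        using C(2)[of "eps\<^sup>2" d] eps unfolding ln_eps L_def[symmetric] N_def by (simp add: power_le_one)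
      then have "ln (real N) \<le> ln (C ^ d * exp (\<eta> / (2 * K) * (2 * ln y + real d * L) powr t))"
        using False by (intro ln_mono) auto
      also have "\<dots> = real d * c + \<eta> / (2 * K) * (2 * ln y + real d * L) powr t"
        using C(1) by (simp add: ln_mult ln_realpow c_def)
      also have "\<dots> \<le> \<eta> * (y powr s + real d powr t)"
        using lin R by (simp add: ring_distribs)
      finally show ?thesis by (simp add: N_def y_def)
    qed
  qed
  then show ?thesis by blast
qed

end

theorem theorem1p1:
  fixes s t :: real
    and S1 :: "'h::{real_inner,complete_space} \<Rightarrow> 'g::{real_inner,complete_space}"
    and lam :: "nat \<Rightarrow> real"
    and tau :: "nat \<Rightarrow> (nat \<Rightarrow> 'h) \<Rightarrow> 'hd::{real_inner,complete_space}"
    and tau' :: "nat \<Rightarrow> (nat \<Rightarrow> 'g) \<Rightarrow> 'gd::{real_inner,complete_space}"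
    and H :: "nat \<Rightarrow> 'hd set"
    and G :: "nat \<Rightarrow> 'gd set"
    and S :: "nat \<Rightarrow> 'hd \<Rightarrow> 'gd"
  assumes "s > 0" and "t > 0"
    and "compact_operator S1"
    and "\<not> (\<exists>B :: 'h set. finite B \<and> span B = UNIV)"
    and "ordered_eigenvalues (adjoint S1 \<circ> S1) lam"
    and "\<And>d. d \<ge> 1 \<Longrightarrow> hilbert_tensor_power d (tau d) (H d)"
    and "\<And>d. d \<ge> 1 \<Longrightarrow> hilbert_tensor_power d (tau' d) (G d)"
    and "\<And>d. d \<ge> 1 \<Longrightarrow> tensor_power_operator S1 (tau d) (tau' d) (S d)"
    and "lam 2 > 0" and "lam 1 > 1"
  shows "ALG_weakly_tractable s t H G S \<longleftrightarrow>
    t > 1 \<and> (\<lambda>j. log_ratio t (lam j) j) \<longlonglongrightarrow> \<infinity>"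
proof (rule compact_operator_eigenbasis[OF assms(3,5)])
  fix e :: "nat \<Rightarrow> 'h"
  assume e: "lam \<longlonglongrightarrow> 0"
    "\<And>i j. 1 \<le> i \<Longrightarrow> 1 \<le> j \<Longrightarrow> e i \<bullet> e j = (if i = j \<and> lam i > 0 then 1 else 0)"
    "\<And>i j. 1 \<le> i \<Longrightarrow> 1 \<le> j \<Longrightarrow> S1 (e i) \<bullet> S1 (e j) = (if i = j then lam i else 0)"
    "\<And>f g. (\<lambda>m. \<Sum>j=1..m. lam j * ((f \<bullet> e j) * (g \<bullet> e j))) \<longlonglongrightarrow> S1 f \<bullet> S1 g"
  interpret nontrivial_eigenvalue_sequence lam
    using assms(5,9,10) e(1) by unfold_locales (auto simp: ordered_eigenvalues_def)
  \<comment> \<open>This reduces the problem to the numbers \<open>lam j\<close>: the complexity is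
    replaced by the count on the whole range of the limit.\<close>
  have n_ABS: "n_ABS (H d) (G d) (S d) eps = card (large_indices lam d (eps\<^sup>2))"
    if "1 \<le> d" "0 < eps" for d eps
  proof -
    interpret tensor_eigenbasis lam S1 e d "tau d" "H d" "tau' d" "G d" "S d"
      by unfold_locales (rule e(2-4) assms(6-8) that(1) | assumption)+
    show ?thesis using that(2) by (rule n_ABS_eq_card)
  qed
  have tract_iff: "ALG_weakly_tractable s t H G S \<longleftrightarrow>
    (\<forall>\<eta>>0. \<exists>X. \<forall>eps d. 0 < eps \<and> eps < 1 \<and> 1 \<le> d \<and> X \<le> 1 / eps + real d \<longrightarrow>
      ln (real (card (large_indices lam d (eps\<^sup>2)))) \<le> \<eta> * ((1 / eps) powr s + real d powr t))"
    unfolding ALG_weakly_tractable_def weak_tractability_limit_iff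
    using n_ABS by (simp cong: conj_cong imp_cong)
  show ?thesis
  proof
    assume "ALG_weakly_tractable s t H G S"
    note tract = this[unfolded tract_iff]
    show "t > 1 \<and> (\<lambda>j. log_ratio t (lam j) j) \<longlonglongrightarrow> \<infinity>"
      using tractable_imp_t_gt_1[OF assms(2) tract] tractable_imp_log_ratio[OF assms(2) tract] by blast
  next
    assume "t > 1 \<and> (\<lambda>j. log_ratio t (lam j) j) \<longlonglongrightarrow> \<infinity>"
    then show "ALG_weakly_tractable s t H G S"
      unfolding tract_iff using log_ratio_imp_tractable[OF assms(1)] by blast
  qed
qed

end
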